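(* There is a constant $c_n$ depending only on the dimension $n$ such that the following holds. Suppose that $p>1$, $v\in A_p$ and $u\in A_1$ on $\mathbb{R}^n$. Then, for every $f\in L^1(uv)$, $$\Big\|\frac{M(fv)}{v}\Big\|_{L^{1,\infty}(uv)}\le c_n\,[u]_{A_1}[v]_{A_\infty}\Big([u]_{A_1}[v]_{A_\infty}+[u]_{A_\infty}\max\{p,\,1+\log([v]_{A_p}+1)\}\Big)\|f\|_{L^1(uv)}.$$
   Context: A weight is a non-negative locally integrable function on $\mathbb{R}^n$, positive a.e. $Mf(x)=\sup_{Q\ni x}\frac1{|Q|}\int_Q|f|$ is the Hardy--Littlewood maximal operator, the supremum over cubes $Q$ with sides parallel to the axes. $u\in A_1$ means $[u]_{A_1}=\operatorname{ess\,sup}_x Mu(x)/u(x)<\infty$. For $1<p<\infty$, $v\in A_p$ means $[v]_{A_p}=\sup_Q\big(\frac1{|Q|}\int_Q v\big)\big(\frac1{|Q|}\int_Q v^{-1/(p-1)}\big)^{p-1}<\infty$. The $A_\infty$ constant is the Fujii--Wilson constant $[w]_{A_\infty}=\sup_Q \frac{1}{w(Q)}\int_Q M(w\chi_Q)\,dx$. The product $uv$ need not be locally integrable; $uv$ also denotes the measure $u(x)v(x)\,dx$, $\|f\|_{L^1(uv)}=\int_{\mathbb{R}^n}|f|uv\,dx$ and $\|h\|_{L^{1,\infty}(uv)}=\sup_{t>0}t\,(uv)(\{x:|h(x)|>t\})$. *)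

theory Defs
  imports "HOL-Analysis.Analysis" "HOL-Probability.Essential_Supremum"
begin

definition cubes :: "(real ^ 'n) set set" where
  "cubes = {cbox a (a + (\<chi> i. l)) | a l. 0 < l}"

definition average :: "(real ^ 'n) set \<Rightarrow> (real ^ 'n \<Rightarrow> ennreal) \<Rightarrow> ennreal" where
  "average Q g = (\<integral>\<^sup>+x\<in>Q. g x \<partial>lebesgue) / emeasure lebesgue Q"

definition maximal :: "(real ^ 'n \<Rightarrow> real) \<Rightarrow> real ^ 'n \<Rightarrow> ennreal" where
  "maximal f x = (SUP Q\<in>{Q \<in> cubes. x \<in> Q}. average Q (\<lambda>y. ennreal \<bar>f y\<bar>))"

definition weight :: "(real ^ 'n \<Rightarrow> real) \<Rightarrow> bool" where
  "weight w \<longleftrightarrow> w \<in> borel_measurable lebesgue \<and> (\<forall>x. 0 \<le> w x) \<and>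
     (\<forall>K. compact K \<longrightarrow> w absolutely_integrable_on K) \<and> (AE x in lebesgue. 0 < w x)"

(* Where the weight in a denominator vanishes (a null set), the quotient has its ennreal value
   (a / 0 is top if a > 0, and 0 / 0 = 0). *)
definition A1_const :: "(real ^ 'n \<Rightarrow> real) \<Rightarrow> ennreal" where
  "A1_const u = esssup lebesgue (\<lambda>x. maximal u x / ennreal (u x))"

(* Real powers of extended nonnegative numbers; only positive exponents a are used. *)
definition ennreal_powr :: "ennreal \<Rightarrow> real \<Rightarrow> ennreal" where
  "ennreal_powr x a = (if x = top then top else ennreal (enn2real x powr a))"

(* On the null set where v vanishes, v x powr (- 1 / (p - 1)) is 0. *)
definition Ap_const :: "real \<Rightarrow> (real ^ 'n \<Rightarrow> real) \<Rightarrow> ennreal" where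
  "Ap_const p v =
     (SUP Q\<in>cubes. average Q (\<lambda>x. ennreal (v x)) *
        ennreal_powr (average Q (\<lambda>x. ennreal (v x powr (- 1 / (p - 1))))) (p - 1))"

definition Ainf_const :: "(real ^ 'n \<Rightarrow> real) \<Rightarrow> ennreal" where
  "Ainf_const w =
     (SUP Q\<in>cubes. (\<integral>\<^sup>+x\<in>Q. maximal (\<lambda>y. w y * indicator Q y) x \<partial>lebesgue) /
        (\<integral>\<^sup>+x\<in>Q. ennreal (w x) \<partial>lebesgue))"

definition A1_class :: "(real ^ 'n \<Rightarrow> real) set" where
  "A1_class = {u. weight u \<and> A1_const u < top}"

definition Ap_class :: "real \<Rightarrow> (real ^ 'n \<Rightarrow> real) set" where
  "Ap_class p = {v. weight v \<and> Ap_const p v < top}"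

definition uv_measure ::
  "(real ^ 'n \<Rightarrow> real) \<Rightarrow> (real ^ 'n \<Rightarrow> real) \<Rightarrow> (real ^ 'n) measure" where
  "uv_measure u v = density lebesgue (\<lambda>x. ennreal (u x * v x))"

definition L1_norm :: "'a measure \<Rightarrow> ('a \<Rightarrow> real) \<Rightarrow> ennreal" where
  "L1_norm \<mu> f = (\<integral>\<^sup>+x. ennreal \<bar>f x\<bar> \<partial>\<mu>)"

(* For nonnegative extended-valued h, so that |h| = h. *)
definition weak_L1_norm :: "'a measure \<Rightarrow> ('a \<Rightarrow> ennreal) \<Rightarrow> ennreal" where
  "weak_L1_norm \<mu> h = (SUP t\<in>{0<..}. ennreal t * emeasure \<mu> {x \<in> space \<mu>. ennreal t < h x})"

end

theory Submission
  imports Defs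
begin

text \<open>
  Every cube lies in a cell of comparable size of one of \<open>2^n\<close> triadic grids, so it suffices to bound
  \<open>uv {v < M_F g}\<close> for a finite family \<open>F\<close> of grid cells. A point with \<open>2^k < v \<le> 2^(k+1)\<close> in this
  set lies in a maximal cell \<open>I\<close> of \<open>F\<close> on which \<open>g\<close> has average above \<open>2^k\<close>; sort the pairs \<open>(I, k)\<close> by
  the integer \<open>m = k - avg_level v I\<close>, which compares \<open>2^k\<close> with the average of \<open>v\<close> over \<open>I\<close>.

  For fixed \<open>m\<close>, the sum of \<open>2^k u(I)\<close> is at most \<open>8 [v]\<^bsub>A\<infinity>\<^esub> [u]\<^bsub>A1\<^esub> \<integral>gu\<close>: cells on which \<open>v\<close> has different dyadic
  averages obey a Carleson packing condition by the Fujii--Wilson condition, and a layer-cake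
  decomposition in the averages of \<open>u\<close> together with the \<open>A1\<close> condition replaces \<open>u(I) / |I|\<close> by \<open>u(x)\<close>.

  For varying \<open>m\<close>, the portion of \<open>I\<close> on which \<open>v\<close> is about \<open>2^k\<close> is a fraction at most \<open>2^(-m)\<close> of \<open>I\<close> when
  \<open>m \<ge> 0\<close> (Chebyshev) and, up to \<open>log [v]\<^bsub>Ap\<^esub>\<close> exceptional \<open>m\<close>, at most \<open>2^(m/(p-1))\<close> when \<open>m < 0\<close> (\<open>Ap\<close> condition);
  the \<open>A\<infinity>\<close> property of \<open>u\<close> turns this into geometric decay with ratio \<open>1 - c / ([u]\<^bsub>A\<infinity>\<^esub> p)\<close>. Hence the sum over \<open>m\<close>
  costs \<open>[u]\<^bsub>A\<infinity>\<^esub> max {p, 1 + log ([v]\<^bsub>Ap\<^esub> + 1)}\<close>.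
\<close>

section \<open>Triadic grids\<close>

text \<open>For fixed \<open>k\<close> these are half-open cubes of side 3^(-k), so generations get
  finer as \<open>k\<close> grows. The lattice is moved by half a side in the coordinates where
  \<open>\<alpha>\<close> holds. Labelling cells by floors reduces nesting to integer division by
  3.\<close>

definition tcell :: "('n \<Rightarrow> bool) \<Rightarrow> int \<Rightarrow> ('n \<Rightarrow> int) \<Rightarrow> (real ^ 'n) set" where
  "tcell \<alpha> k m = {x. \<forall>i. \<lfloor>3 powi k * x $ i - of_bool (\<alpha> i) / 2\<rfloor> = m i}"

definition grid :: "('n \<Rightarrow> bool) \<Rightarrow> (real ^ 'n) set set" where
  "grid \<alpha> = {Q. Q \<noteq> {} \<and> (\<exists>k m. Q = tcell \<alpha> k m)}"

definition cell_at :: "('n \<Rightarrow> bool) \<Rightarrow> int \<Rightarrow> real ^ 'n \<Rightarrow> (real ^ 'n) set" where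
  "cell_at \<alpha> k x = tcell \<alpha> k (\<lambda>i. \<lfloor>3 powi k * x $ i - of_bool (\<alpha> i) / 2\<rfloor>)"

lemma cell_at_self: "x \<in> cell_at \<alpha> k x"
  by (simp add: cell_at_def tcell_def)

lemma cell_at_grid: "cell_at \<alpha> k x \<in> grid \<alpha>"
  using cell_at_self[of x \<alpha> k] by (auto simp: grid_def cell_at_def)

lemma cell_at_eq: "x \<in> tcell \<alpha> k m \<Longrightarrow> cell_at \<alpha> k x = tcell \<alpha> k m"
  by (simp add: cell_at_def tcell_def)

lemma grid_cell_at:
  assumes "Q \<in> grid \<alpha>"
  shows "\<exists>k. \<forall>x\<in>Q. Q = cell_at \<alpha> k x"
proof -
  obtain k m where "Q = tcell \<alpha> k m" using assms by (auto simp: grid_def)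
  then have "\<forall>x\<in>Q. Q = cell_at \<alpha> k x" by (simp add: cell_at_eq)
  then show ?thesis ..
qed

text \<open>The shift by \<open>1/2\<close> keeps triadic grids nested because \<open>3/2 - 1/2\<close> is an integer.\<close>

lemma floor_coarser:
  fixes y :: real
  shows "\<lfloor>3 powi k * y - of_bool a / 2\<rfloor> = (\<lfloor>3 powi (k + 1) * y - of_bool a / 2\<rfloor> - of_bool a) div 3"
proof -
  define z where "z = 3 powi k * y - of_bool a / 2"
  have "3 powi (k + 1) * y - of_bool a / 2 = 3 * z + of_int (of_bool a)"
    by (simp add: z_def power_int_add algebra_simps)
  then have "\<lfloor>3 powi (k + 1) * y - of_bool a / 2\<rfloor> - of_bool a = \<lfloor>3 * z\<rfloor>"
    by (simp del: of_int_of_bool)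
  moreover have "\<lfloor>z\<rfloor> = \<lfloor>3 * z\<rfloor> div 3"
    by linarith
  ultimately show ?thesis by (simp add: z_def)
qed

lemma cell_at_mono_Suc: "cell_at \<alpha> (k + 1) x \<subseteq> cell_at \<alpha> k x"
  unfolding cell_at_def tcell_def by (auto simp: floor_coarser[of k])

lemma cell_at_mono: "j \<le> k \<Longrightarrow> cell_at \<alpha> k x \<subseteq> cell_at \<alpha> j x"
  by (induction k rule: int_ge_induct) (use cell_at_mono_Suc in blast)+

text \<open>Through a common point both sets are cells of some generation at that same point, and
  those form a decreasing chain.\<close>

lemma grid_laminar:
  assumes "R \<in> grid \<alpha>" "S \<in> grid \<alpha>" "R \<inter> S \<noteq> {}"
  shows "R \<subseteq> S \<or> S \<subseteq> R"
proof -
  obtain x where x: "x \<in> R" "x \<in> S" using assms by auto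
  obtain j k where "R = cell_at \<alpha> j x" "S = cell_at \<alpha> k x"
    using grid_cell_at assms x by metis
  then show ?thesis using cell_at_mono[of j k] cell_at_mono[of k j] by (metis linear)
qed

section \<open>Cells as half-open cubes: boundary, measure, countability\<close>

lemma tcell_box:
  fixes \<alpha> :: "'n::finite \<Rightarrow> bool"
  defines "a \<equiv> (\<lambda>k m. (\<chi> i. (of_int (m i) + of_bool (\<alpha> i) / 2) * 3 powi (- k)) :: real ^ 'n)"
  shows "tcell \<alpha> k m = {x. \<forall>i. a k m $ i \<le> x $ i \<and> x $ i < a k m $ i + 3 powi (- k)}"
proof -
  have "\<lfloor>3 powi k * t - c\<rfloor> = j \<longleftrightarrow> (of_int j + c) * 3 powi (- k) \<le> t \<and> t < (of_int j + c) * 3 powi (- k) + 3 powi (- k)"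
    for t c :: real and j
  proof -
    have "(0::real) < 3 powi k" by simp
    then show ?thesis
      by (auto simp: floor_eq_iff power_int_minus field_simps)
  qed
  then show ?thesis by (auto simp: tcell_def a_def)
qed

lemma ennreal_numeral_power: "ennreal (numeral k ^ n) = numeral k ^ n"
  by (metis ennreal_numeral ennreal_power zero_le_numeral)

lemma emeasure_cube:
  assumes "0 < l"
  shows "emeasure lebesgue (cbox a (a + (\<chi> i. l)) :: (real ^ 'n) set) = ennreal (l ^ CARD('n))"
proof -
  have 1: "(a + (\<chi> i. l)) \<bullet> b - a \<bullet> b = l" if "b \<in> Basis" for b :: "real ^ 'n"
    using that by (auto simp: Basis_vec_def inner_axis' inner_add_left inner_axis)
  have "emeasure lborel (cbox a (a + (\<chi> i. l))) = ennreal (\<Prod>b\<in>Basis. (a + (\<chi> i. l) - a) \<bullet> (b :: real ^ 'n))"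
    using 1 assms by (intro emeasure_lborel_cbox) (auto simp: inner_add_left)
  also have "(\<Prod>b\<in>Basis. (a + (\<chi> i. l) - a) \<bullet> (b :: real ^ 'n)) = (\<Prod>b\<in>(Basis :: (real ^ 'n) set). l)"
    using 1 by (intro prod.cong) (auto simp: inner_diff_left inner_add_left)
  finally show ?thesis by simp
qed

text \<open>The constants of the weights are suprema over closed cubes, whereas cells are half-open.
  As the missing boundary is null, those constants can be tested on cells.\<close>

lemma grid_cube:
  fixes Q :: "(real ^ 'n) set"
  assumes "Q = cell_at \<alpha> k x"
  shows "\<exists>a. Q \<subseteq> cbox a (a + (\<chi> i. 3 powi (- k))) \<and> cbox a (a + (\<chi> i. 3 powi (- k))) - Q \<in> null_sets lebesgue"
proof -
  define l :: real where "l = 3 powi (- k)"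
  obtain a where Q: "Q = {x. \<forall>i. a $ i \<le> x $ i \<and> x $ i < a $ i + l}"
    using assms unfolding cell_at_def tcell_box l_def by blast
  let ?b = "a + (\<chi> i. l)"
  have sub: "Q \<subseteq> cbox a ?b" by (auto simp: Q cbox_def Basis_vec_def inner_axis intro: less_imp_le)
  have "box a ?b \<subseteq> Q" by (auto simp: Q box_def Basis_vec_def inner_axis intro: less_imp_le)
  then have "cbox a ?b - Q \<subseteq> cbox a ?b - box a ?b" by auto
  moreover have "negligible (cbox a ?b - box a ?b)" by (rule negligible_frontier_interval)
  ultimately have "negligible (cbox a ?b - Q)" using negligible_subset by blast
  with sub show ?thesis unfolding l_def negligible_iff_null_sets by blast
qed

lemma sets_cell_at [measurable]: "cell_at \<alpha> k (x :: real ^ 'n) \<in> sets lebesgue"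
proof -
  obtain a where a: "cell_at \<alpha> k x \<subseteq> cbox a (a + (\<chi> i. 3 powi (- k)))"
      "cbox a (a + (\<chi> i. 3 powi (- k))) - cell_at \<alpha> k x \<in> null_sets lebesgue"
    using grid_cube by blast
  have "cell_at \<alpha> k x = cbox a (a + (\<chi> i. 3 powi (- k))) - (cbox a (a + (\<chi> i. 3 powi (- k))) - cell_at \<alpha> k x)"
    using a(1) by auto
  also have "\<dots> \<in> sets lebesgue" using a(2) by (meson sets.Diff null_setsD2 lmeasurable_cbox fmeasurableD)
  finally show ?thesis .
qed

lemma emeasure_cell_at: "emeasure lebesgue (cell_at \<alpha> k (x :: real ^ 'n)) = ennreal ((3 powi (- k)) ^ CARD('n))"
proof -
  obtain a where a: "cell_at \<alpha> k x \<subseteq> cbox a (a + (\<chi> i. 3 powi (- k)))"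
      "cbox a (a + (\<chi> i. 3 powi (- k))) - cell_at \<alpha> k x \<in> null_sets lebesgue"
    using grid_cube by blast
  have "cell_at \<alpha> k x = cbox a (a + (\<chi> i. 3 powi (- k))) - (cbox a (a + (\<chi> i. 3 powi (- k))) - cell_at \<alpha> k x)"
    using a(1) by auto
  then have "emeasure lebesgue (cell_at \<alpha> k x) = emeasure lebesgue (cbox a (a + (\<chi> i. 3 powi (- k))))"
    using emeasure_Diff_null_set[OF a(2), of "cbox a (a + (\<chi> i. 3 powi (- k)))"] by simp
  then show ?thesis using emeasure_cube[of "3 powi (- k)" a] by simp
qed

lemma grid_obtains:
  assumes "Q \<in> grid \<alpha>"
  obtains k x where "Q = cell_at \<alpha> k x"
proof -
  obtain x where "x \<in> Q" using assms by (auto simp: grid_def)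
  then show ?thesis using grid_cell_at[OF assms] that by blast
qed

lemma sets_grid [measurable]: "(Q :: (real ^ 'n) set) \<in> grid \<alpha> \<Longrightarrow> Q \<in> sets lebesgue"
  by (erule grid_obtains) simp

lemma emeasure_grid:
  assumes "(Q :: (real ^ 'n) set) \<in> grid \<alpha>"
  shows "emeasure lebesgue Q \<noteq> 0" "emeasure lebesgue Q \<noteq> top"
proof -
  obtain k x where "Q = cell_at \<alpha> k x" using assms by (rule grid_obtains)
  then show "emeasure lebesgue Q \<noteq> 0" "emeasure lebesgue Q \<noteq> top"
    by (auto simp: emeasure_cell_at ennreal_eq_0_iff not_le)
qed

lemma grid_closure:
  assumes "(Q :: (real ^ 'n) set) \<in> grid \<alpha>"
  obtains C where "C \<in> cubes" "Q \<subseteq> C" "C - Q \<in> null_sets lebesgue"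
proof -
  obtain k x where "Q = cell_at \<alpha> k x" using assms by (rule grid_obtains)
  then obtain a where a: "Q \<subseteq> cbox a (a + (\<chi> i. 3 powi (- k)))"
      "cbox a (a + (\<chi> i. 3 powi (- k))) - Q \<in> null_sets lebesgue"
    using grid_cube by blast
  moreover have "cbox a (a + (\<chi> i. 3 powi (- k))) \<in> cubes"
    unfolding cubes_def
    by (rule CollectI, rule exI[of _ a], rule exI[of _ "3 powi (- k)"]) (simp add: zero_less_power_int)
  ultimately show ?thesis using that by blast
qed

lemma countable_grid: "countable (grid \<alpha> :: (real ^ 'n) set set)"
proof -
  have sub: "grid \<alpha> \<subseteq> (\<lambda>z. tcell \<alpha> (fst z) (snd z)) ` ((UNIV :: int set) \<times> (UNIV :: ('n \<Rightarrow> int) set))"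
  proof
    fix Q assume "Q \<in> grid \<alpha>"
    then obtain k m where "Q = tcell \<alpha> k m" unfolding grid_def by blast
    then show "Q \<in> (\<lambda>z. tcell \<alpha> (fst z) (snd z)) ` ((UNIV :: int set) \<times> (UNIV :: ('n \<Rightarrow> int) set))"
      by (intro image_eqI[of _ _ "(k, m)"]) simp_all
  qed
  have "countable ((UNIV :: int set) \<times> (UNIV :: ('n \<Rightarrow> int) set))"
    by (intro countable_SIGMA countableI_type)
  then show ?thesis by (rule countable_subset[OF sub countable_image])
qed

lemma cell_at_parent_measure:
  "emeasure lebesgue (cell_at \<alpha> k (x :: real ^ 'n)) = 3 ^ CARD('n) * emeasure lebesgue (cell_at \<alpha> (k + 1) x)"
proof -
  have "3 powi (- k) = 3 * (3 powi (- (k + 1)) :: real)"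
    using power_int_add_1[of "3::real" "- (k + 1)"] by simp
  then have "(3 powi (- k) :: real) ^ CARD('n) = 3 ^ CARD('n) * (3 powi (- (k + 1))) ^ CARD('n)"
    by (simp only: power_mult_distrib)
  then have "ennreal ((3 powi (- k) :: real) ^ CARD('n)) = ennreal (3 ^ CARD('n)) * ennreal ((3 powi (- (k + 1))) ^ CARD('n))"
    by (simp only: ennreal_mult zero_le_power zero_le_numeral zero_le_power_int)
  then show ?thesis
    unfolding emeasure_cell_at ennreal_numeral_power .
qed

text \<open>The breakpoints of the unshifted and of the shifted grid together have spacing \<open>1/2\<close>, so a shorter
  interval misses those of one of the two.\<close>

lemma floor_shift_half:
  fixes a b :: real
  assumes "a \<le> b" "b - a < 1 / 2"
  shows "\<exists>c::bool. \<forall>z\<in>{a..b}. \<lfloor>z - of_bool c / 2\<rfloor> = \<lfloor>a - of_bool c / 2\<rfloor>"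
proof -
  have const: "\<lfloor>z - d\<rfloor> = \<lfloor>a - d\<rfloor>" if "\<lfloor>b - d\<rfloor> = \<lfloor>a - d\<rfloor>" "z \<in> {a..b}" for d z :: real
  proof (rule antisym)
    have "\<lfloor>z - d\<rfloor> \<le> \<lfloor>b - d\<rfloor>" using that(2) by (intro floor_mono) auto
    then show "\<lfloor>z - d\<rfloor> \<le> \<lfloor>a - d\<rfloor>" unfolding that(1) .
    show "\<lfloor>a - d\<rfloor> \<le> \<lfloor>z - d\<rfloor>" using that(2) by (intro floor_mono) auto
  qed
  show ?thesis
  proof (cases "\<lfloor>b\<rfloor> = \<lfloor>a\<rfloor>")
    case True
    have "\<forall>z\<in>{a..b}. \<lfloor>z - of_bool False / 2\<rfloor> = \<lfloor>a - of_bool False / 2\<rfloor>"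
      by (rule ballI, rule const) (simp_all add: True)
    then show ?thesis ..
  next
    case False
    define n where "n = \<lfloor>a\<rfloor>"
    have n: "of_int n \<le> a" "a < of_int n + 1" unfolding n_def using floor_correct[of a] by simp_all
    have "n < \<lfloor>b\<rfloor>" using False floor_mono[OF assms(1)] unfolding n_def by simp
    then have "of_int (n + 1) \<le> b" unfolding le_floor_iff[symmetric] by simp
    then have nb: "of_int n + 1 \<le> b" by simp
    have "\<lfloor>b - 1 / 2\<rfloor> = n" using assms n nb by (intro floor_unique) linarith+
    moreover have "\<lfloor>a - 1 / 2\<rfloor> = n" using assms n nb by (intro floor_unique) linarith+
    ultimately have eq: "\<lfloor>b - 1 / 2\<rfloor> = \<lfloor>a - 1 / 2\<rfloor>" by simp
    have "\<forall>z\<in>{a..b}. \<lfloor>z - of_bool True / 2\<rfloor> = \<lfloor>a - of_bool True / 2\<rfloor>"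
      by (rule ballI, rule const) (simp_all add: eq)
    then show ?thesis ..
  qed
qed

text \<open>At a generation where the side of \<open>C\<close> is less than half a cell side,
  \<open>floor_shift_half\<close> gives for each coordinate a shift with no breakpoint inside the
  cube. The coordinates choose independently, whence 2^n grids.\<close>

lemma cube_in_grid_cell:
  fixes C :: "(real ^ 'n) set"
  assumes "C \<in> cubes"
  obtains \<alpha> R where "R \<in> grid \<alpha>" "C \<subseteq> R" "emeasure lebesgue R \<le> 6 ^ CARD('n) * emeasure lebesgue C"
proof -
  obtain a l where C: "C = cbox a (a + (\<chi> i. l))" "0 < l" using assms by (auto simp: cubes_def)
  \<comment> \<open>The least triadic scale above twice the side, so that 2l < 3^j <= 6l; generation
    \<open>- j\<close> has side 3^j. The upper bound yields the factor 6^n.\<close>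
  define j where "j = \<lfloor>log 3 (2 * l)\<rfloor> + 1"
  have j: "2 * l < 3 powi j" "3 powi j \<le> 6 * l"
  proof -
    have "log 3 (2 * l) < of_int j" "of_int j \<le> log 3 (2 * l) + 1" unfolding j_def by linarith+
    moreover have "(3::real) powi j = 3 powr of_int j" by (rule powr_real_of_int'[symmetric]) simp_all
    moreover have "3 powr (log 3 (2 * l)) = 2 * l" "3 powr (log 3 (2 * l) + 1) = 6 * l"
      using C by (auto simp: powr_add)
    ultimately show "2 * l < 3 powi j" "3 powi j \<le> 6 * l"
      using powr_less_mono[of "log 3 (2 * l)" "of_int j" 3] powr_mono[of "of_int j" "log 3 (2 * l) + 1" 3] by simp_all
  qed
  let ?s = "3 powi (- j) :: real"
  have s: "?s * l < 1 / 2" "0 < ?s" using j by (simp_all add: power_int_minus field_simps)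
  have "\<exists>c::bool. \<forall>z\<in>{?s * a $ i..?s * (a $ i + l)}. \<lfloor>z - of_bool c / 2\<rfloor> = \<lfloor>?s * a $ i - of_bool c / 2\<rfloor>" for i
    using s C(2) by (intro floor_shift_half) (auto simp: algebra_simps)
  then obtain \<alpha> where \<alpha>: "\<And>i z. z \<in> {?s * a $ i..?s * (a $ i + l)} \<Longrightarrow> \<lfloor>z - of_bool (\<alpha> i) / 2\<rfloor> = \<lfloor>?s * a $ i - of_bool (\<alpha> i) / 2\<rfloor>"
    using choice[of "\<lambda>i c. \<forall>z\<in>{?s * a $ i..?s * (a $ i + l)}. \<lfloor>z - of_bool c / 2\<rfloor> = \<lfloor>?s * a $ i - of_bool c / 2\<rfloor>"] by blast
  have "C \<subseteq> cell_at \<alpha> (- j) a"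
  proof
    fix x assume "x \<in> C"
    then have "a $ i \<le> x $ i \<and> x $ i \<le> a $ i + l" for i
      by (auto simp: C mem_box_cart)
    then have "?s * x $ i \<in> {?s * a $ i..?s * (a $ i + l)}" for i using s by auto
    then show "x \<in> cell_at \<alpha> (- j) a" unfolding cell_at_def tcell_def using \<alpha> by blast
  qed
  moreover have "emeasure lebesgue (cell_at \<alpha> (- j) a) \<le> 6 ^ CARD('n) * emeasure lebesgue C"
  proof -
    have "(3 powi j) ^ CARD('n) \<le> (6 * l) ^ CARD('n)"
      using j(2) by (intro power_mono) auto
    then have "(3 powi j) ^ CARD('n) \<le> 6 ^ CARD('n) * l ^ CARD('n)"
      unfolding power_mult_distrib .
    then have "ennreal ((3 powi j) ^ CARD('n)) \<le> ennreal (6 ^ CARD('n) * l ^ CARD('n))" by (rule ennreal_leI)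
    also have "\<dots> = 6 ^ CARD('n) * ennreal (l ^ CARD('n))"
      using C(2) by (subst ennreal_mult) (auto simp only: ennreal_numeral_power intro: zero_le_power)
    finally show ?thesis
      unfolding C(1) emeasure_cube[OF C(2)] emeasure_cell_at by simp
  qed
  ultimately show ?thesis using that cell_at_grid by blast
qed

section \<open>Weights on grid cells\<close>

abbreviation wmeas :: "(real ^ 'n \<Rightarrow> real) \<Rightarrow> (real ^ 'n) measure" where
  "wmeas w \<equiv> density lebesgue (\<lambda>x. ennreal (w x))"

text \<open>At a point in no cell of the family the value is 0, the supremum of the empty set in
  \<open>ennreal\<close>. The family is a parameter because full grids, finite families and the
  cells below a given one all occur.\<close>

definition grid_max :: "(real ^ 'n) set set \<Rightarrow> (real ^ 'n \<Rightarrow> ennreal) \<Rightarrow> real ^ 'n \<Rightarrow> ennreal" where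
  "grid_max \<F> h x = (SUP R\<in>{R \<in> \<F>. x \<in> R}. average R h)"

lemma ennreal_divide_mult_cancel: "b \<noteq> 0 \<Longrightarrow> b \<noteq> top \<Longrightarrow> (a / b) * b = (a :: ennreal)"
  by (simp add: ennreal_divide_times ennreal_divide_self less_top)

lemma average_mult:
  assumes "(Q :: (real ^ 'n) set) \<in> grid \<alpha>"
  shows "average Q h * emeasure lebesgue Q = (\<integral>\<^sup>+x\<in>Q. h x \<partial>lebesgue)"
  unfolding average_def using emeasure_grid[OF assms] by (rule ennreal_divide_mult_cancel)

lemma null_closure:
  assumes "Q \<subseteq> C" "C - Q \<in> null_sets lebesgue" "C \<in> sets lebesgue"
  shows "(\<integral>\<^sup>+x\<in>C. h x \<partial>lebesgue) = (\<integral>\<^sup>+x\<in>Q. h x \<partial>lebesgue)"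
    "emeasure lebesgue C = emeasure lebesgue Q" "average C h = average Q h"
proof -
  have "AE x in lebesgue. x \<notin> C - Q" using assms(2) by (rule AE_not_in)
  then have "AE x in lebesgue. h x * indicator C x = h x * indicator Q x"
    using assms(1) by (auto simp: indicator_def elim!: AE_mp)
  then show 1: "(\<integral>\<^sup>+x\<in>C. h x \<partial>lebesgue) = (\<integral>\<^sup>+x\<in>Q. h x \<partial>lebesgue)"
    by (rule nn_integral_cong_AE)
  have "Q = C - (C - Q)" using assms(1) by auto
  then show 2: "emeasure lebesgue C = emeasure lebesgue Q"
    using emeasure_Diff_null_set[OF assms(2,3)] by simp
  show "average C h = average Q h" by (simp add: average_def 1 2)
qed

lemma cubes_lebesgue: "C \<in> cubes \<Longrightarrow> C \<in> sets lebesgue"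
  by (auto simp: cubes_def)

section \<open>Weights as measures\<close>

lemma emeasure_wmeas:
  assumes "weight w" "A \<in> sets lebesgue"
  shows "emeasure (wmeas w) A = (\<integral>\<^sup>+x\<in>A. ennreal (w x) \<partial>lebesgue)"
  using assms by (intro emeasure_density) (auto simp: weight_def)

text \<open>A weight is positive almost everywhere, so Lebesgue measure is absolutely continuous
  with respect to it. This keeps w(Q) away from 0 as a denominator.\<close>

lemma wmeas_eq_0:
  assumes "weight w" "A \<in> sets lebesgue" "emeasure (wmeas w) A = 0"
  shows "emeasure lebesgue A = 0"
proof -
  have [measurable]: "w \<in> borel_measurable lebesgue" "A \<in> sets lebesgue" using assms by (auto simp: weight_def)
  have "(\<integral>\<^sup>+x. ennreal (w x) * indicator A x \<partial>lebesgue) = 0"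
    using assms(3) unfolding emeasure_wmeas[OF assms(1,2)] .
  then have "AE x in lebesgue. ennreal (w x) * indicator A x = 0"
    by (subst (asm) nn_integral_0_iff_AE) measurable
  moreover have "AE x in lebesgue. 0 < w x" using assms(1) by (simp add: weight_def)
  ultimately have "AE x in lebesgue. x \<notin> A"
    by eventually_elim (auto simp: indicator_def split: if_splits)
  then show ?thesis using AE_iff_measurable[of A lebesgue "\<lambda>x. x \<notin> A"] by simp
qed

lemma wmeas_compact_finite:
  assumes "weight w" "compact K" "A \<subseteq> K" "A \<in> sets lebesgue"
  shows "emeasure (wmeas w) A \<noteq> top"
proof -
  have "w absolutely_integrable_on K" using assms by (simp add: weight_def)
  then have "integrable lebesgue (\<lambda>x. indicator K x *\<^sub>R w x)" by (simp add: set_integrable_def)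
  then have "(\<integral>\<^sup>+x. ennreal (norm (indicator K x *\<^sub>R w x)) \<partial>lebesgue) < \<infinity>"
    by (simp only: integrable_iff_bounded)
  moreover have "emeasure (wmeas w) A \<le> (\<integral>\<^sup>+x. ennreal (norm (indicator K x *\<^sub>R w x)) \<partial>lebesgue)"
    unfolding emeasure_wmeas[OF assms(1,4)] using assms(1,3)
    by (intro nn_integral_mono) (auto simp: indicator_def weight_def)
  ultimately show ?thesis by auto
qed

lemma grid_bounded_compact:
  assumes "(Q :: (real ^ 'n) set) \<in> grid \<alpha>"
  obtains K where "compact K" "Q \<subseteq> K"
  using grid_closure[OF assms] by (auto simp: cubes_def) (metis compact_cbox)

lemma wmeas_grid:
  assumes "weight w" "(Q :: (real ^ 'n) set) \<in> grid \<alpha>"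
  shows "emeasure (wmeas w) Q \<noteq> 0" "emeasure (wmeas w) Q \<noteq> top"
proof -
  show "emeasure (wmeas w) Q \<noteq> 0"
    using wmeas_eq_0[OF assms(1) sets_grid[OF assms(2)]] emeasure_grid(1)[OF assms(2)] by blast
  obtain K where "compact K" "Q \<subseteq> K" using grid_bounded_compact[OF assms(2)] .
  then show "emeasure (wmeas w) Q \<noteq> top"
    using wmeas_compact_finite[OF assms(1)] sets_grid[OF assms(2)] by blast
qed

lemma average_wmeas:
  assumes "weight w" "(Q :: (real ^ 'n) set) \<in> grid \<alpha>"
  shows "average Q (\<lambda>x. ennreal (w x)) = emeasure (wmeas w) Q / emeasure lebesgue Q"
    "average Q (\<lambda>x. ennreal (w x)) * emeasure lebesgue Q = emeasure (wmeas w) Q"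
    "average Q (\<lambda>x. ennreal (w x)) \<noteq> 0" "average Q (\<lambda>x. ennreal (w x)) \<noteq> top"
proof -
  show 1: "average Q (\<lambda>x. ennreal (w x)) = emeasure (wmeas w) Q / emeasure lebesgue Q"
    unfolding average_def emeasure_wmeas[OF assms(1) sets_grid[OF assms(2)]] ..
  show "average Q (\<lambda>x. ennreal (w x)) * emeasure lebesgue Q = emeasure (wmeas w) Q"
    unfolding 1 using emeasure_grid[OF assms(2)] by (rule ennreal_divide_mult_cancel)
  show "average Q (\<lambda>x. ennreal (w x)) \<noteq> 0" "average Q (\<lambda>x. ennreal (w x)) \<noteq> top"
    unfolding 1 using emeasure_grid[OF assms(2)] wmeas_grid[OF assms]
    by (auto simp: ennreal_divide_eq_top_iff ennreal_divide_eq_0_iff)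
qed

section \<open>The Fujii--Wilson and A_1 conditions on cells\<close>

lemma grid_average_le_maximal:
  assumes "(R :: (real ^ 'n) set) \<in> grid \<alpha>" "x \<in> R"
    and "\<And>y. y \<in> R \<Longrightarrow> h y \<le> ennreal \<bar>f y\<bar>"
  shows "average R h \<le> maximal f x"
proof -
  obtain C where C: "C \<in> cubes" "R \<subseteq> C" "C - R \<in> null_sets lebesgue" using grid_closure[OF assms(1)] .
  have "average R h \<le> average R (\<lambda>y. ennreal \<bar>f y\<bar>)"
    unfolding average_def using assms(3)
    by (intro divide_right_mono_ennreal nn_integral_mono) (auto simp: indicator_def)
  also have "\<dots> = average C (\<lambda>y. ennreal \<bar>f y\<bar>)"
    using null_closure(3)[OF C(2,3) cubes_lebesgue[OF C(1)]] by simp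
  also have "\<dots> \<le> maximal f x"
    unfolding maximal_def using C assms(2) by (intro SUP_upper) auto
  finally show ?thesis .
qed

text \<open>Let \<open>C\<close> be the closed cube of \<open>F\<close>. Cells inside
  \<open>F\<close> only see \<open>w\<close> on \<open>C\<close>, so the local grid maximal function
  is below M(w chi_C), whose integral over \<open>C\<close> the constant controls; \<open>C\<close>
  and \<open>F\<close> have the same w-mass.\<close>

lemma Ainf_grid:
  assumes w: "weight w" and F: "(F :: (real ^ 'n) set) \<in> grid \<alpha>" and \<F>: "\<F> \<subseteq> grid \<alpha>"
  shows "(\<integral>\<^sup>+x\<in>F. grid_max {R \<in> \<F>. R \<subseteq> F} (\<lambda>y. ennreal (w y)) x \<partial>lebesgue) \<le> Ainf_const w * emeasure (wmeas w) F"
proof -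
  obtain C where C: "C \<in> cubes" "F \<subseteq> C" "C - F \<in> null_sets lebesgue" using grid_closure[OF F] .
  have Cs: "C \<in> sets lebesgue" using C cubes_lebesgue by blast
  have eq: "(\<integral>\<^sup>+x\<in>C. ennreal (w x) \<partial>lebesgue) = emeasure (wmeas w) F"
    unfolding null_closure(1)[OF C(2,3) Cs] emeasure_wmeas[OF w sets_grid[OF F]] ..
  have "grid_max {R \<in> \<F>. R \<subseteq> F} (\<lambda>y. ennreal (w y)) x \<le> maximal (\<lambda>y. w y * indicator C y) x" for x
    unfolding grid_max_def
  proof (rule SUP_least, clarify)
    fix R assume "R \<in> \<F>" "R \<subseteq> F" "x \<in> R"
    then show "average R (\<lambda>y. ennreal (w y)) \<le> maximal (\<lambda>y. w y * indicator C y) x"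
      using \<F> C by (intro grid_average_le_maximal[of R \<alpha>]) (auto simp: indicator_def)
  qed
  then have "(\<integral>\<^sup>+x\<in>F. grid_max {R \<in> \<F>. R \<subseteq> F} (\<lambda>y. ennreal (w y)) x \<partial>lebesgue)
      \<le> (\<integral>\<^sup>+x\<in>C. maximal (\<lambda>y. w y * indicator C y) x \<partial>lebesgue)"
    using C(2) by (intro nn_integral_mono) (auto simp: indicator_def)
  also have "\<dots> = (\<integral>\<^sup>+x\<in>C. maximal (\<lambda>y. w y * indicator C y) x \<partial>lebesgue) / emeasure (wmeas w) F * emeasure (wmeas w) F"
    using ennreal_divide_mult_cancel[OF wmeas_grid[OF w F]] by simp
  also have "\<dots> \<le> Ainf_const w * emeasure (wmeas w) F"
    unfolding Ainf_const_def eq[symmetric] using C(1) by (intro mult_right_mono SUP_upper) auto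
  finally show ?thesis .
qed

text \<open>Test on one cell with the one-element family: the maximal function dominates the average
  on the whole cell.\<close>

lemma Ainf_ge_1:
  assumes w: "weight (w :: real ^ 'n \<Rightarrow> real)"
  shows "1 \<le> Ainf_const w"
proof -
  define F :: "(real ^ 'n) set" where "F = cell_at (\<lambda>_. False) 0 0"
  have F: "F \<in> grid (\<lambda>_. False)" unfolding F_def by (rule cell_at_grid)
  have "emeasure (wmeas w) F = (\<integral>\<^sup>+x\<in>F. average F (\<lambda>y. ennreal (w y)) \<partial>lebesgue)"
    using average_wmeas(2)[OF w F] sets_grid[OF F] by (simp add: nn_integral_cmult_indicator)
  also have "\<dots> \<le> (\<integral>\<^sup>+x\<in>F. grid_max {R \<in> {F}. R \<subseteq> F} (\<lambda>y. ennreal (w y)) x \<partial>lebesgue)"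
    by (intro nn_integral_mono) (auto simp: grid_max_def indicator_def intro!: SUP_upper)
  also have "\<dots> \<le> Ainf_const w * emeasure (wmeas w) F"
    using F by (intro Ainf_grid[OF w F]) auto
  finally have "1 * emeasure (wmeas w) F \<le> Ainf_const w * emeasure (wmeas w) F" by simp
  then show ?thesis
    using wmeas_grid[OF w F] by (metis ennreal_mult_le_mult_iff mult.commute)
qed

lemma A1_maximal:
  assumes "weight u" "A1_const u < top"
  shows "AE y in lebesgue. maximal u y \<le> A1_const u * ennreal (u y)"
proof -
  have "AE y in lebesgue. maximal u y / ennreal (u y) \<le> A1_const u"
    unfolding A1_const_def by (rule esssup_AE)
  moreover have "AE y in lebesgue. 0 < u y" using assms by (simp add: weight_def)
  ultimately show ?thesis
  proof eventually_elim
    case (elim y)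
    have "maximal u y = maximal u y / ennreal (u y) * ennreal (u y)"
      using elim by (subst ennreal_divide_mult_cancel) auto
    also have "\<dots> \<le> A1_const u * ennreal (u y)" using elim by (intro mult_right_mono) auto
    finally show ?case .
  qed
qed

text \<open>Each average over a cell through y is at most Mu(y), so the single null set from
  \<open>A1_maximal\<close> serves all cells at once.\<close>

lemma A1_grid:
  assumes "weight u" "A1_const u < top"
  shows "AE y in lebesgue. \<forall>Q\<in>grid \<alpha>. y \<in> Q \<longrightarrow> average Q (\<lambda>x. ennreal (u x)) \<le> A1_const u * ennreal (u y)"
  using A1_maximal[OF assms]
proof eventually_elim
  case (elim y)
  show ?case
  proof (intro ballI impI)
    fix Q assume "Q \<in> grid \<alpha>" "y \<in> Q"
    then have "average Q (\<lambda>x. ennreal (u x)) \<le> maximal u y"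
      by (intro grid_average_le_maximal[of Q \<alpha>]) (auto intro: ennreal_leI)
    then show "average Q (\<lambda>x. ennreal (u x)) \<le> A1_const u * ennreal (u y)" using elim by (rule order_trans)
  qed
qed

lemma maximal_mono: "(\<And>y. \<bar>f y\<bar> \<le> \<bar>g y\<bar>) \<Longrightarrow> maximal f x \<le> maximal g x"
  unfolding maximal_def average_def
  by (intro SUP_mono' divide_right_mono_ennreal nn_integral_mono mult_right_mono ennreal_leI) auto

text \<open>Pointwise M(u chi_C) <= Mu <= [u]_{A_1} u almost everywhere. Its use is that the
  A_infinity constant of \<open>u\<close> is finite and can be handled as a real number.\<close>

lemma Ainf_le_A1:
  assumes u: "weight (u :: real ^ 'n \<Rightarrow> real)" "A1_const u < top"
  shows "Ainf_const u \<le> A1_const u"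
  unfolding Ainf_const_def
proof (rule SUP_least)
  fix C :: "(real ^ 'n) set" assume C: "C \<in> cubes"
  have [measurable]: "u \<in> borel_measurable lebesgue" "C \<in> sets lebesgue"
    using u cubes_lebesgue[OF C] by (auto simp: weight_def)
  have "(\<integral>\<^sup>+x\<in>C. maximal (\<lambda>y. u y * indicator C y) x \<partial>lebesgue) \<le> (\<integral>\<^sup>+x. A1_const u * (ennreal (u x) * indicator C x) \<partial>lebesgue)"
  proof (rule nn_integral_mono_AE)
    show "AE x in lebesgue. maximal (\<lambda>y. u y * indicator C y) x * indicator C x \<le> A1_const u * (ennreal (u x) * indicator C x)"
      using A1_maximal[OF u]
    proof eventually_elim
      case (elim x)
      have "maximal (\<lambda>y. u y * indicator C y) x \<le> maximal u x"
        by (intro maximal_mono) (auto simp: indicator_def)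
      then show ?case using elim by (auto simp: indicator_def)
    qed
  qed
  also have "\<dots> = A1_const u * (\<integral>\<^sup>+x\<in>C. ennreal (u x) \<partial>lebesgue)"
    by (rule nn_integral_cmult) measurable
  finally have "(\<integral>\<^sup>+x\<in>C. maximal (\<lambda>y. u y * indicator C y) x \<partial>lebesgue) \<le> A1_const u * (\<integral>\<^sup>+x\<in>C. ennreal (u x) \<partial>lebesgue)" .
  moreover have "(\<integral>\<^sup>+x\<in>C. ennreal (u x) \<partial>lebesgue) \<noteq> 0"
  proof
    assume "(\<integral>\<^sup>+x\<in>C. ennreal (u x) \<partial>lebesgue) = 0"
    then have "emeasure lebesgue C = 0"
      using wmeas_eq_0[OF u(1), of C] emeasure_wmeas[OF u(1), of C] by simp
    then show False using C by (auto simp: cubes_def emeasure_cube simp del: emeasure_completion)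
  qed
  ultimately show "(\<integral>\<^sup>+x\<in>C. maximal (\<lambda>y. u y * indicator C y) x \<partial>lebesgue) / (\<integral>\<^sup>+x\<in>C. ennreal (u x) \<partial>lebesgue) \<le> A1_const u"
    by (intro divide_le_posI_ennreal) (auto simp: mult.commute zero_less_iff_neq_zero)
qed

section \<open>Dyadic levels of averages\<close>

definition avg_level :: "(real ^ 'n \<Rightarrow> real) \<Rightarrow> (real ^ 'n) set \<Rightarrow> int" where
  "avg_level w Q = \<lceil>log 2 (enn2real (average Q (\<lambda>x. ennreal (w x))))\<rceil>"

lemma avg_level:
  assumes "weight w" "(Q :: (real ^ 'n) set) \<in> grid \<alpha>"
  shows "ennreal (2 powi (avg_level w Q - 1)) < average Q (\<lambda>x. ennreal (w x))"
    "average Q (\<lambda>x. ennreal (w x)) \<le> ennreal (2 powi (avg_level w Q))"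
proof -
  define a where "a = enn2real (average Q (\<lambda>x. ennreal (w x)))"
  have a: "average Q (\<lambda>x. ennreal (w x)) = ennreal a" "0 < a"
    unfolding a_def using average_wmeas(3,4)[OF assms]
    by (auto simp: less_top enn2real_positive_iff zero_less_iff_neq_zero)
  have k: "of_int (avg_level w Q - 1) < log 2 a" "log 2 a \<le> of_int (avg_level w Q)"
    unfolding avg_level_def a_def[symmetric] using ceiling_correct[of "log 2 a"] by simp_all
  have "(2::real) powi j = 2 powr of_int j" for j by (rule powr_real_of_int'[symmetric]) simp_all
  moreover have "2 powr log 2 a = a" using a by simp
  ultimately have "2 powi (avg_level w Q - 1) < a" "a \<le> 2 powi (avg_level w Q)"
    using powr_less_mono[OF k(1), of 2] powr_mono[OF k(2), of 2] by simp_all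
  then show "ennreal (2 powi (avg_level w Q - 1)) < average Q (\<lambda>x. ennreal (w x))"
    "average Q (\<lambda>x. ennreal (w x)) \<le> ennreal (2 powi (avg_level w Q))"
    unfolding a(1) using a(2) by (auto simp: ennreal_less_iff intro: ennreal_leI)
qed

lemma sum_powi_le:
  assumes "finite K" "\<forall>k\<in>K. k \<le> (m::int)"
  shows "(\<Sum>k\<in>K. (2::real) powi k) \<le> 2 * 2 powi m"
  using assms
proof (induction K arbitrary: m rule: finite_linorder_max_induct)
  case (insert b A)
  have "(\<Sum>k\<in>A. (2::real) powi k) \<le> 2 * 2 powi (b - 1)"
    using insert.hyps by (intro insert.IH) auto
  also have "\<dots> = 2 powi b" using power_int_add_1[of "2::real" "b - 1"] by simp
  finally have "(\<Sum>k\<in>insert b A. (2::real) powi k) \<le> 2 * 2 powi b"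
    using insert.hyps by (subst sum.insert) auto
  also have "\<dots> \<le> 2 * 2 powi m" using insert.prems by (auto intro: power_int_increasing)
  finally show ?case .
qed simp

text \<open>Distinct powers of 2 sum to at most twice the largest, and the largest term is bounded
  by \<open>h\<close>.\<close>

lemma sum_levels_le:
  assumes "finite K" "\<And>k. k \<in> K \<Longrightarrow> ennreal (2 powi k) * c \<le> h"
  shows "(\<Sum>k\<in>K. ennreal (2 powi k) * c) \<le> 2 * h"
proof (cases "K = {}")
  case False
  have "(\<Sum>k\<in>K. ennreal (2 powi k)) = ennreal (\<Sum>k\<in>K. 2 powi k)" by (rule sum_ennreal) simp
  also have "\<dots> \<le> ennreal (2 * 2 powi (Max K))"
    using assms(1) by (intro ennreal_leI sum_powi_le) auto
  also have "\<dots> = 2 * ennreal (2 powi (Max K))" by (simp add: ennreal_mult)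
  finally have "(\<Sum>k\<in>K. ennreal (2 powi k)) * c \<le> 2 * ennreal (2 powi (Max K)) * c" by (rule mult_right_mono) simp
  also have "\<dots> \<le> 2 * h" using assms(2)[OF Max_in[OF assms(1) False]] by (simp add: mult.assoc mult_left_mono)
  finally show ?thesis by (simp only: sum_distrib_right)
qed simp

section \<open>Sublevel sets under the A_p condition\<close>

lemma ennreal_powr_mono: "x \<le> y \<Longrightarrow> 0 \<le> a \<Longrightarrow> ennreal_powr x a \<le> ennreal_powr y a"
  by (auto simp: ennreal_powr_def less_top top_unique intro!: ennreal_leI powr_mono2 enn2real_mono)

text \<open>On \<open>E\<close> the dual weight v^(-1/(p-1)) is at least t^(-1/(p-1)), so its
  average over \<open>Q\<close> is at least e t^(-1/(p-1)) with e = |E|/|Q|. The A_p condition then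
  gives a e^(p-1) / t <= [v]_{A_p}, to be solved for e. Positivity of \<open>v\<close> on
  \<open>E\<close> matters because \<open>0 powr\<close> anything is 0, not infinite.\<close>

lemma Ap_small_set:
  assumes p: "1 < p" and v: "weight v" "Ap_const p v < top" and Q: "(Q :: (real ^ 'n) set) \<in> grid \<alpha>"
    and a: "0 < a" "ennreal a \<le> average Q (\<lambda>x. ennreal (v x))"
    and E: "E \<in> sets lebesgue" "E \<subseteq> Q" "\<And>x. x \<in> E \<Longrightarrow> 0 < v x \<and> v x \<le> t" and t: "0 < t"
  shows "emeasure lebesgue E \<le> ennreal ((enn2real (Ap_const p v) * t / a) powr (1 / (p - 1))) * emeasure lebesgue Q"
proof -
  define s where "s = 1 / (p - 1)"
  have s: "0 < s" using p by (simp add: s_def)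
  define B where "B = enn2real (Ap_const p v)"
  have B: "Ap_const p v = ennreal B" "0 \<le> B" using v by (auto simp: B_def less_top)
  obtain C where C: "C \<in> cubes" "Q \<subseteq> C" "C - Q \<in> null_sets lebesgue" using grid_closure[OF Q] .
  define e where "e = measure lebesgue E / measure lebesgue Q"
  have fin: "emeasure lebesgue E \<noteq> top"
    using emeasure_mono[OF E(2) sets_grid[OF Q]] emeasure_grid(2)[OF Q] by (auto simp: top_unique)
  have mQ: "emeasure lebesgue Q = ennreal (measure lebesgue Q)"
    by (rule emeasure_eq_ennreal_measure[OF emeasure_grid(2)[OF Q]])
  have mQ0: "0 < measure lebesgue Q"
    using emeasure_grid(1)[OF Q] unfolding mQ by (simp add: zero_less_measure_iff)
  have mE: "emeasure lebesgue E = ennreal (measure lebesgue E)"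
    by (rule emeasure_eq_ennreal_measure[OF fin])
  have e0: "0 \<le> e" by (simp add: e_def)
  have eE: "emeasure lebesgue E = ennreal e * emeasure lebesgue Q"
    unfolding mE mQ using mQ0 by (simp add: e_def flip: ennreal_mult)
  have "ennreal (e * t powr (- s)) * emeasure lebesgue Q = (\<integral>\<^sup>+x. ennreal (t powr (- s)) * indicator E x \<partial>lebesgue)"
    unfolding nn_integral_cmult_indicator[OF E(1)] eE using e0 by (simp add: ennreal_mult ac_simps)
  also have "\<dots> \<le> (\<integral>\<^sup>+x\<in>Q. ennreal (v x powr (- 1 / (p - 1))) \<partial>lebesgue)"
  proof (intro nn_integral_mono)
    fix x
    have "t powr (- s) \<le> v x powr (- s)" if "x \<in> E"
      using E(3)[OF that] s by (intro powr_mono2') auto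
    then show "ennreal (t powr (- s)) * indicator E x \<le> ennreal (v x powr (- 1 / (p - 1))) * indicator Q x"
      using E(2) by (auto simp: indicator_def s_def intro!: ennreal_leI)
  qed
  also have "\<dots> = average Q (\<lambda>x. ennreal (v x powr (- 1 / (p - 1)))) * emeasure lebesgue Q"
    using average_mult[OF Q] by simp
  finally have "ennreal (e * t powr (- s)) \<le> average Q (\<lambda>x. ennreal (v x powr (- 1 / (p - 1))))"
    using emeasure_grid[OF Q] by (metis ennreal_mult_le_mult_iff mult.commute)
  then have "ennreal_powr (ennreal (e * t powr (- s))) (p - 1) \<le> ennreal_powr (average Q (\<lambda>x. ennreal (v x powr (- 1 / (p - 1))))) (p - 1)"
    using p by (intro ennreal_powr_mono) auto
  then have "ennreal a * ennreal_powr (ennreal (e * t powr (- s))) (p - 1)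
      \<le> average Q (\<lambda>x. ennreal (v x)) * ennreal_powr (average Q (\<lambda>x. ennreal (v x powr (- 1 / (p - 1))))) (p - 1)"
    using a(2) by (intro mult_mono) auto
  also have "\<dots> \<le> Ap_const p v"
    unfolding Ap_const_def null_closure(3)[OF C(2,3) cubes_lebesgue[OF C(1)], symmetric]
    by (rule SUP_upper[OF C(1)])
  also have "ennreal_powr (ennreal (e * t powr (- s))) (p - 1) = ennreal (e powr (p - 1) / t)"
    using e0 t p by (simp add: ennreal_powr_def powr_divide powr_powr s_def powr_minus_divide)
  finally have "a * (e powr (p - 1) / t) \<le> B"
    using a(1) t B by (simp add: ennreal_le_iff flip: ennreal_mult)
  then have "e powr (p - 1) \<le> B * t / a" using a t by (simp add: field_simps)
  then have "(e powr (p - 1)) powr s \<le> (B * t / a) powr s"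
    using s by (intro powr_mono2) auto
  then have "e \<le> (B * t / a) powr s" using e0 p by (simp add: powr_powr s_def)
  then show ?thesis unfolding eE s_def[symmetric] B_def[symmetric] by (intro mult_right_mono ennreal_leI) auto
qed

section \<open>A Carleson estimate and the level sums\<close>

lemma grid_max_upper: "R \<in> \<F> \<Longrightarrow> x \<in> R \<Longrightarrow> average R h \<le> grid_max \<F> h x"
  unfolding grid_max_def by (intro SUP_upper) auto

lemma measurable_grid_max:
  assumes "finite \<F>" "\<F> \<subseteq> grid \<alpha>"
  shows "grid_max \<F> h \<in> borel_measurable lebesgue"
proof -
  have "grid_max \<F> h = (\<lambda>x. SUP R\<in>\<F>. average R h * indicator R x)"
  proof (intro ext antisym)
    fix x
    show "grid_max \<F> h x \<le> (SUP R\<in>\<F>. average R h * indicator R x)"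
      unfolding grid_max_def
    proof (rule SUP_least)
      fix R assume R: "R \<in> {R \<in> \<F>. x \<in> R}"
      then have "average R h = average R h * indicator R x" by simp
      also have "\<dots> \<le> (SUP R\<in>\<F>. average R h * indicator R x)" using R by (intro SUP_upper) auto
      finally show "average R h \<le> (SUP R\<in>\<F>. average R h * indicator R x)" .
    qed
    show "(SUP R\<in>\<F>. average R h * indicator R x) \<le> grid_max \<F> h x"
    proof (rule SUP_least)
      fix R assume "R \<in> \<F>"
      then show "average R h * indicator R x \<le> grid_max \<F> h x"
        using grid_max_upper[of R \<F> x h] by (auto simp: indicator_def)
    qed
  qed
  also have "\<dots> \<in> borel_measurable lebesgue"
    using assms sets_grid by (intro borel_measurable_SUP countable_finite borel_measurable_times_ennreal borel_measurable_indicator borel_measurable_const) blast+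
  finally show ?thesis .
qed

definition tops :: "'a set set \<Rightarrow> 'a set set" where
  "tops \<F> = {F \<in> \<F>. \<forall>J\<in>\<F>. F \<subseteq> J \<longrightarrow> J = F}"

lemma tops_exists:
  assumes "finite \<F>" "R \<in> \<F>"
  shows "\<exists>F\<in>tops \<F>. R \<subseteq> F"
proof -
  obtain F where "F \<in> \<F>" "R \<subseteq> F" "\<forall>J\<in>\<F>. F \<subseteq> J \<longrightarrow> F = J"
    using finite_has_maximal2[OF assms] by blast
  then show ?thesis by (intro bexI[of _ F]) (auto simp: tops_def)
qed

lemma tops_subset: "tops \<F> \<subseteq> \<F>"
  by (auto simp: tops_def)

lemma Union_tops: "finite \<F> \<Longrightarrow> \<Union>(tops \<F>) = \<Union>\<F>"
  using tops_exists[of \<F>] tops_subset[of \<F>] by blast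

lemma tops_disjoint:
  assumes "\<F> \<subseteq> grid \<alpha>" "F \<in> tops \<F>" "G \<in> tops \<F>" "F \<noteq> G"
  shows "F \<inter> G = {}"
proof (rule ccontr)
  assume "F \<inter> G \<noteq> {}"
  then have "F \<subseteq> G \<or> G \<subseteq> F" using assms(1-3) grid_laminar[of F \<alpha> G] by (auto simp: tops_def)
  then show False using assms(2-4) by (auto simp: tops_def)
qed

text \<open>By laminarity the maximal cells partition the union. The measure is left general since
  Lebesgue measure, weights and densities of maximal functions are all inserted.\<close>

lemma emeasure_Union_tops:
  assumes "finite \<F>" "\<F> \<subseteq> grid \<alpha>" "sets \<mu> = sets (lebesgue :: (real ^ 'n) measure)"
  shows "emeasure \<mu> (\<Union>\<F>) = (\<Sum>F\<in>tops \<F>. emeasure \<mu> F)"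
proof -
  have "(\<Sum>F\<in>tops \<F>. emeasure \<mu> F) = emeasure \<mu> (\<Union>F\<in>tops \<F>. F)"
  proof (rule sum_emeasure)
    show "(\<lambda>F. F) ` tops \<F> \<subseteq> sets \<mu>"
      using tops_subset[of \<F>] assms(2) sets_grid unfolding assms(3) by blast
    show "disjoint_family_on (\<lambda>F. F) (tops \<F>)"
      using tops_disjoint[OF assms(2)] by (auto simp: disjoint_family_on_def)
    show "finite (tops \<F>)" using assms(1) tops_subset by (rule finite_subset[rotated])
  qed
  then show ?thesis using Union_tops[OF assms(1)] by simp
qed

section \<open>The Carleson packing estimate\<close>

lemma ennreal_powi_add: "ennreal (2 powi (a + b)) = ennreal (2 powi a) * ennreal (2 powi b)"
  by (simp add: power_int_add ennreal_mult)

lemma ennreal_powi_Suc: "ennreal (2 powi k) = 2 * ennreal (2 powi (k - 1))"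
  using ennreal_powi_add[of 1 "k - 1"] by simp

lemma avg_level_measure:
  assumes "weight w" "(Q :: (real ^ 'n) set) \<in> grid \<alpha>"
  shows "ennreal (2 powi (avg_level w Q)) * emeasure lebesgue Q \<le> 2 * emeasure (wmeas w) Q"
    "emeasure (wmeas w) Q \<le> ennreal (2 powi (avg_level w Q)) * emeasure lebesgue Q"
proof -
  have "ennreal (2 powi (avg_level w Q)) \<le> 2 * average Q (\<lambda>x. ennreal (w x))"
    unfolding ennreal_powi_Suc[of "avg_level w Q"] using avg_level(1)[OF assms] by (intro mult_left_mono less_imp_le) auto
  then have "ennreal (2 powi (avg_level w Q)) * emeasure lebesgue Q \<le> 2 * average Q (\<lambda>x. ennreal (w x)) * emeasure lebesgue Q"
    by (rule mult_right_mono) simp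
  then show "ennreal (2 powi (avg_level w Q)) * emeasure lebesgue Q \<le> 2 * emeasure (wmeas w) Q"
    unfolding mult.assoc average_wmeas(2)[OF assms] .
  have "average Q (\<lambda>x. ennreal (w x)) * emeasure lebesgue Q \<le> ennreal (2 powi (avg_level w Q)) * emeasure lebesgue Q"
    using avg_level(2)[OF assms] by (rule mult_right_mono) simp
  then show "emeasure (wmeas w) Q \<le> ennreal (2 powi (avg_level w Q)) * emeasure lebesgue Q"
    unfolding average_wmeas(2)[OF assms] .
qed

text \<open>Cells through a given point have pairwise different levels, so the sum of their 2^level
  is geometric and comparable to the grid maximal function of \<open>v\<close> there. Integrating
  over \<open>F\<close> and applying the Fujii--Wilson condition gives the packing bound.\<close>

lemma carleson:
  assumes v: "weight v" and \<Gamma>: "finite \<Gamma>" "\<Gamma> \<subseteq> grid \<alpha>" and F: "(F :: (real ^ 'n) set) \<in> grid \<alpha>"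
    and sub: "\<And>I. I \<in> \<Gamma> \<Longrightarrow> I \<subseteq> F"
    and disj: "\<And>I J. I \<in> \<Gamma> \<Longrightarrow> J \<in> \<Gamma> \<Longrightarrow> avg_level v I = avg_level v J \<Longrightarrow> I \<noteq> J \<Longrightarrow> I \<inter> J = {}"
  shows "(\<Sum>I\<in>\<Gamma>. emeasure (wmeas v) I) \<le> 4 * (Ainf_const v * emeasure (wmeas v) F)"
proof -
  let ?h = "grid_max {R \<in> \<Gamma>. R \<subseteq> F} (\<lambda>y. ennreal (v y))"
  have eq: "{R \<in> \<Gamma>. R \<subseteq> F} = \<Gamma>" using sub by auto
  have [measurable]: "?h \<in> borel_measurable lebesgue" "F \<in> sets lebesgue"
    unfolding eq using measurable_grid_max[OF \<Gamma>] sets_grid[OF F] by auto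
  \<comment> \<open>Of the constant 4, one factor 2 comes from rounding averages up to powers of 2
    and the other from the geometric sum.\<close>
  have pt: "(\<Sum>I\<in>\<Gamma>. ennreal (2 powi (avg_level v I)) * indicator I x) \<le> 4 * (?h x * indicator F x)" for x
  proof (cases "x \<in> F")
    case True
    define G where "G = {I \<in> \<Gamma>. x \<in> I}"
    have G: "finite G" "G \<subseteq> \<Gamma>" using \<Gamma> by (auto simp: G_def)
    have inj: "inj_on (avg_level v) G"
    proof (rule inj_onI, rule ccontr)
      fix I J assume IJ: "I \<in> G" "J \<in> G" "avg_level v I = avg_level v J" "I \<noteq> J"
      then have "I \<inter> J = {}" using G(2) by (intro disj) auto
      then show False using IJ by (auto simp: G_def)
    qed
    have "(\<Sum>I\<in>\<Gamma>. ennreal (2 powi (avg_level v I)) * indicator I x) = (\<Sum>I\<in>G. ennreal (2 powi (avg_level v I)) * 1)"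
      using \<Gamma>(1) unfolding G_def by (intro sum.mono_neutral_cong_right) (auto simp: indicator_def)
    also have "\<dots> = (\<Sum>k\<in>avg_level v ` G. ennreal (2 powi k) * 1)"
      using sum.reindex[OF inj, of "\<lambda>k. ennreal (2 powi k) * 1"] by (simp only: o_def)
    also have "\<dots> \<le> 2 * (2 * ?h x)"
    proof (rule sum_levels_le)
      show "finite (avg_level v ` G)" using G by simp
      fix k assume "k \<in> avg_level v ` G"
      then obtain I where I: "I \<in> G" "k = avg_level v I" by auto
      have Ig: "I \<in> grid \<alpha>" using I G \<Gamma> by auto
      have "ennreal (2 powi (k - 1)) \<le> average I (\<lambda>y. ennreal (v y))"
        using avg_level(1)[OF v Ig] I by simp
      also have "\<dots> \<le> ?h x" using I sub unfolding eq by (intro grid_max_upper) (auto simp: G_def)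
      finally show "ennreal (2 powi k) * 1 \<le> 2 * ?h x"
        unfolding ennreal_powi_Suc[of k] mult_1_right by (rule mult_left_mono) simp
    qed
    also have "\<dots> = 4 * (?h x * indicator F x)" using True by (simp flip: mult.assoc)
    finally show ?thesis .
  next
    case False
    then have "\<And>I. I \<in> \<Gamma> \<Longrightarrow> x \<notin> I" using sub by blast
    then show ?thesis by simp
  qed
  have "(\<Sum>I\<in>\<Gamma>. emeasure (wmeas v) I) \<le> (\<Sum>I\<in>\<Gamma>. ennreal (2 powi (avg_level v I)) * emeasure lebesgue I)"
    using avg_level_measure(2)[OF v] \<Gamma> by (intro sum_mono) blast
  also have "\<dots> = (\<Sum>I\<in>\<Gamma>. \<integral>\<^sup>+x. ennreal (2 powi (avg_level v I)) * indicator I x \<partial>lebesgue)"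
    using \<Gamma> sets_grid by (intro sum.cong refl nn_integral_cmult_indicator[symmetric]) blast
  also have "\<dots> = (\<integral>\<^sup>+x. (\<Sum>I\<in>\<Gamma>. ennreal (2 powi (avg_level v I)) * indicator I x) \<partial>lebesgue)"
    using \<Gamma> sets_grid
    by (intro nn_integral_sum[symmetric] borel_measurable_times_ennreal borel_measurable_indicator borel_measurable_const) blast
  also have "\<dots> \<le> (\<integral>\<^sup>+x. 4 * (?h x * indicator F x) \<partial>lebesgue)"
    by (intro nn_integral_mono pt)
  also have "\<dots> = 4 * (\<integral>\<^sup>+x\<in>F. ?h x \<partial>lebesgue)"
    by (rule nn_integral_cmult) measurable
  also have "\<dots> \<le> 4 * (Ainf_const v * emeasure (wmeas v) F)"
    by (intro mult_left_mono Ainf_grid[OF v F \<Gamma>(2)]) simp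
  finally show ?thesis .
qed

section \<open>The estimate for one value of \<open>m\<close>\<close>

lemma sigma_finite_lebesgue: "sigma_finite_measure (lebesgue :: 'a::euclidean_space measure)"
proof -
  obtain A :: "'a set set" where A: "countable A" "A \<subseteq> sets lborel" "\<Union>A = space lborel"
      "\<forall>a\<in>A. emeasure lborel a \<noteq> \<infinity>"
    using lborel.sigma_finite_countable by blast
  then have "A \<subseteq> sets lebesgue" "\<forall>a\<in>A. emeasure lebesgue a \<noteq> \<infinity>"
    by (auto simp: subset_eq)
  with A show ?thesis
    by (auto simp: sigma_finite_measure_def intro!: exI[of _ A])
qed

text \<open>The Calderon--Zygmund stopping cells of \<open>g\<close> at height \<open>t\<close>,
  relative to the family.\<close>

definition stop_cubes :: "(real ^ 'n) set set \<Rightarrow> (real ^ 'n \<Rightarrow> ennreal) \<Rightarrow> ennreal \<Rightarrow> (real ^ 'n) set set" where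
  "stop_cubes \<F> g t = tops {I \<in> \<F>. t < average I g}"

text \<open>Write u(I) as the integral over s of |I| on 0 <= s < \<open>a I\<close>, with
  \<open>a I\<close> the average of \<open>u\<close>. For fixed s, group the cells with
  \<open>a I\<close> > s under the maximal ones and apply \<open>carleson\<close> below each. The
  stopping condition turns 2^m v(F) into the integral of \<open>g\<close> over \<open>F\<close>, and
  A_1 places the maximal cells inside {[u]_{A_1} u > s}. Integrating in s restores
  \<open>u\<close>.\<close>

lemma level_sum:
  fixes g :: "real ^ 'n \<Rightarrow> ennreal" and m :: int
  assumes v: "weight v" and u: "weight u" "A1_const u < top"
    and \<F>: "finite \<F>" "\<F> \<subseteq> grid \<alpha>" and g[measurable]: "g \<in> borel_measurable lebesgue"
  defines "thr \<equiv> \<lambda>I. ennreal (2 powi (avg_level v I + m))"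
  defines "\<Gamma> \<equiv> {I \<in> \<F>. I \<in> stop_cubes \<F> g (thr I)}"
  shows "(\<Sum>I\<in>\<Gamma>. thr I * emeasure (wmeas u) I)
    \<le> 8 * Ainf_const v * A1_const u * (\<integral>\<^sup>+x. g x * ennreal (u x) \<partial>lebesgue)"
proof -
  have um[measurable]: "u \<in> borel_measurable lebesgue" and u0: "\<And>x. 0 \<le> u x" using u by (auto simp: weight_def)
  have \<Gamma>: "finite \<Gamma>" "\<Gamma> \<subseteq> grid \<alpha>" using \<F> by (auto simp: \<Gamma>_def)
  have thr: "thr I < average I g" if "I \<in> \<Gamma>" for I
    using that tops_subset by (auto simp: \<Gamma>_def stop_cubes_def)
  \<comment> \<open>Cells with the same level of \<open>v\<close> have the same threshold, so both
    are maximal cells of one family.\<close>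
  have disj: "I \<inter> J = {}" if "I \<in> \<Gamma>" "J \<in> \<Gamma>" "avg_level v I = avg_level v J" "I \<noteq> J" for I J
  proof (rule tops_disjoint)
    show "{I \<in> \<F>. thr J < average I g} \<subseteq> grid \<alpha>" using \<F> by auto
    have "thr I = thr J" using that by (simp add: thr_def)
    then show "I \<in> tops {I \<in> \<F>. thr J < average I g}" "J \<in> tops {I \<in> \<F>. thr J < average I g}"
      using that(1,2) by (auto simp: \<Gamma>_def stop_cubes_def)
  qed fact
  define a where "a = (\<lambda>I. enn2real (average I (\<lambda>x. ennreal (u x))))"
  have a: "average I (\<lambda>x. ennreal (u x)) = ennreal (a I)" "0 \<le> a I" if "I \<in> \<Gamma>" for I
    using average_wmeas(4)[OF u(1), of I \<alpha>] that \<Gamma> by (auto simp: a_def less_top)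
  define A where "A = enn2real (A1_const u)"
  have A: "A1_const u = ennreal A" "0 \<le> A" using u by (auto simp: A_def)
  let ?W = "Ainf_const v"
  define G where "G = density lebesgue g"
  \<comment> \<open>The estimate at a fixed height s. Here 8 = 2 * 4: rounding in
    \<open>avg_level_measure\<close> times the constant of \<open>carleson\<close>.\<close>
  have level: "(\<Sum>I\<in>\<Gamma>. thr I * emeasure lebesgue I * indicator {0..<a I} s)
      \<le> 8 * ?W * (\<integral>\<^sup>+x. g x * indicator {0..<A * u x} s \<partial>lebesgue)" (is "?L \<le> _") for s
  proof (cases "0 \<le> s")
    case s: True
    define S where "S = {I \<in> \<Gamma>. s < a I}"
    have S: "finite S" "S \<subseteq> grid \<alpha>" "S \<subseteq> \<Gamma>" using \<Gamma> by (auto simp: S_def)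
    obtain \<phi> where \<phi>: "\<And>I. I \<in> S \<Longrightarrow> \<phi> I \<in> tops S" "\<And>I. I \<in> S \<Longrightarrow> I \<subseteq> \<phi> I"
      using tops_exists[OF S(1)] by metis
    have tS: "finite (tops S)" "tops S \<subseteq> S" using S(1) tops_subset finite_subset by blast+
    have "?L = (\<Sum>I\<in>S. thr I * emeasure lebesgue I)"
      using \<Gamma>(1) s unfolding S_def by (intro sum.mono_neutral_cong_right) (auto simp: indicator_def)
    also have "\<dots> \<le> (\<Sum>I\<in>S. 2 * ennreal (2 powi m) * emeasure (wmeas v) I)"
    proof (rule sum_mono)
      fix I assume "I \<in> S"
      then have "I \<in> grid \<alpha>" using S by auto
      from avg_level_measure(1)[OF v this]
      have "ennreal (2 powi m) * (ennreal (2 powi avg_level v I) * emeasure lebesgue I) \<le> ennreal (2 powi m) * (2 * emeasure (wmeas v) I)"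
        by (rule mult_left_mono) simp
      then show "thr I * emeasure lebesgue I \<le> 2 * ennreal (2 powi m) * emeasure (wmeas v) I"
        unfolding thr_def ennreal_powi_add by (simp add: ac_simps)
    qed
    also have "\<dots> = 2 * ennreal (2 powi m) * (\<Sum>I\<in>S. emeasure (wmeas v) I)"
      by (rule sum_distrib_left[symmetric])
    \<comment> \<open>\<open>\<phi>\<close> selects one maximal cell above each cell, which splits
      \<open>S\<close> into families to which \<open>carleson\<close> applies separately.\<close>
    also have "(\<Sum>I\<in>S. emeasure (wmeas v) I) = (\<Sum>F\<in>tops S. \<Sum>I\<in>{I \<in> S. \<phi> I = F}. emeasure (wmeas v) I)"
      using S(1) tS(1) \<phi>(1) by (intro sum.group[symmetric]) auto
    also have "\<dots> \<le> (\<Sum>F\<in>tops S. 4 * (?W * emeasure (wmeas v) F))"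
    proof (rule sum_mono)
      fix F assume F: "F \<in> tops S"
      show "(\<Sum>I\<in>{I \<in> S. \<phi> I = F}. emeasure (wmeas v) I) \<le> 4 * (?W * emeasure (wmeas v) F)"
      proof (rule carleson[OF v, of _ \<alpha>])
        show "finite {I \<in> S. \<phi> I = F}" "{I \<in> S. \<phi> I = F} \<subseteq> grid \<alpha>" "F \<in> grid \<alpha>"
          using S(1,2) F tS(2) by auto
        show "I \<subseteq> F" if "I \<in> {I \<in> S. \<phi> I = F}" for I
          using \<phi>(2) that by auto
        show "I \<inter> J = {}" if "I \<in> {I \<in> S. \<phi> I = F}" "J \<in> {I \<in> S. \<phi> I = F}"
          "avg_level v I = avg_level v J" "I \<noteq> J" for I J
          using that S(3) by (intro disj) auto
      qed
    qed
    also have "2 * ennreal (2 powi m) * (\<Sum>F\<in>tops S. 4 * (?W * emeasure (wmeas v) F))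
        = (\<Sum>F\<in>tops S. 8 * ?W * (ennreal (2 powi m) * emeasure (wmeas v) F))"
    proof -
      have "2 * ennreal (2 powi m) * (4 * (?W * y)) = 8 * ?W * (ennreal (2 powi m) * y)" for y
      proof -
        have "2 * ennreal (2 powi m) * (4 * (?W * y)) = (2 * 4) * ?W * (ennreal (2 powi m) * y)"
          by (simp only: ac_simps)
        then show ?thesis by simp
      qed
      then show ?thesis by (simp only: sum_distrib_left)
    qed
    also have "\<dots> \<le> (\<Sum>F\<in>tops S. 8 * ?W * emeasure G F)"
    proof (intro sum_mono mult_left_mono)
      fix F assume "F \<in> tops S"
      then have F: "F \<in> \<Gamma>" "F \<in> grid \<alpha>" using tS S by auto
      \<comment> \<open>Upper rounding of the average of \<open>v\<close> produces exactly the
        threshold of \<open>F\<close>, which the average of \<open>g\<close> exceeds since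
        \<open>F\<close> is itself a stopping cell.\<close>
      have "ennreal (2 powi m) * emeasure (wmeas v) F \<le> ennreal (2 powi m) * (ennreal (2 powi (avg_level v F)) * emeasure lebesgue F)"
        by (intro mult_left_mono avg_level_measure(2)[OF v F(2)]) simp
      also have "\<dots> = thr F * emeasure lebesgue F" unfolding thr_def ennreal_powi_add by (simp add: ac_simps)
      also have "\<dots> \<le> average F g * emeasure lebesgue F" using less_imp_le[OF thr[OF F(1)]] by (rule mult_right_mono) simp
      also have "\<dots> = emeasure G F"
        unfolding average_mult[OF F(2)] G_def using sets_grid[OF F(2)] by (intro emeasure_density[symmetric]) auto
      finally show "ennreal (2 powi m) * emeasure (wmeas v) F \<le> emeasure G F" .
    qed simp
    also have "\<dots> = 8 * ?W * emeasure G (\<Union>S)"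
      unfolding sum_distrib_left[symmetric] by (subst emeasure_Union_tops[OF S(1,2)]) (simp_all add: G_def)
    also have "emeasure G (\<Union>S) = (\<integral>\<^sup>+x. g x * indicator (\<Union>S) x \<partial>lebesgue)"
      unfolding G_def using S sets_grid by (intro emeasure_density g sets.finite_Union) auto
    also have "\<dots> \<le> (\<integral>\<^sup>+x. g x * indicator {0..<A * u x} s \<partial>lebesgue)"
    proof (rule nn_integral_mono_AE)
      \<comment> \<open>For almost every x in a cell \<open>I\<close> of \<open>S\<close>, s <
        \<open>a I\<close> <= A u(x) by the A_1 condition; this is where the average of
        \<open>u\<close> becomes a point value.\<close>
      show "AE x in lebesgue. g x * indicator (\<Union>S) x \<le> g x * indicator {0..<A * u x} s"
        using A1_grid[OF u, of \<alpha>]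
      proof eventually_elim
        case (elim x)
        have "s < A * u x" if xS: "x \<in> \<Union>S"
        proof -
          obtain I where I: "I \<in> S" "x \<in> I" using xS by auto
          then have I': "I \<in> \<Gamma>" "I \<in> grid \<alpha>" using S by auto
          have "ennreal (a I) \<le> A1_const u * ennreal (u x)"
            unfolding a(1)[OF I'(1), symmetric] using elim I(2) I'(2) by blast
          then have "ennreal (a I) \<le> ennreal A * ennreal (u x)"
            unfolding A(1) .
          then have "a I \<le> A * u x" using A(2) u0[of x] by (simp flip: ennreal_mult)
          then show ?thesis using I by (simp add: S_def)
        qed
        then show ?case using s by (auto simp: indicator_def)
      qed
    qed
    finally show ?thesis by (simp add: mult_left_mono)
  qed (auto simp: indicator_def)
  \<comment> \<open>Preparation for exchanging the s and x integrals, with the completed Lebesgue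
    measure as one factor.\<close>
  interpret L: sigma_finite_measure "lebesgue :: (real ^ 'n) measure"
    by (rule sigma_finite_lebesgue)
  interpret P: pair_sigma_finite "lborel :: real measure" "lebesgue :: (real ^ 'n) measure" ..
  have "(\<Sum>I\<in>\<Gamma>. thr I * emeasure (wmeas u) I)
      = (\<Sum>I\<in>\<Gamma>. \<integral>\<^sup>+s. thr I * emeasure lebesgue I * indicator {0..<a I} s \<partial>lborel)"
  proof (rule sum.cong[OF refl])
    fix I assume I: "I \<in> \<Gamma>"
    then have "emeasure (wmeas u) I = ennreal (a I) * emeasure lebesgue I"
      using average_wmeas(2)[OF u(1), of I \<alpha>] a \<Gamma> by auto
    moreover have "(\<integral>\<^sup>+s. thr I * emeasure lebesgue I * indicator {0..<a I} s \<partial>lborel) = thr I * emeasure lebesgue I * ennreal (a I)"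
      using a(2)[OF I] by (subst nn_integral_cmult_indicator) simp_all
    ultimately show "thr I * emeasure (wmeas u) I = (\<integral>\<^sup>+s. thr I * emeasure lebesgue I * indicator {0..<a I} s \<partial>lborel)"
      by (simp only: ac_simps)
  qed
  also have "\<dots> = (\<integral>\<^sup>+s. (\<Sum>I\<in>\<Gamma>. thr I * emeasure lebesgue I * indicator {0..<a I} s) \<partial>lborel)"
    by (rule nn_integral_sum[symmetric]) measurable
  also have "\<dots> \<le> (\<integral>\<^sup>+s. 8 * ?W * (\<integral>\<^sup>+x. g x * indicator {0..<A * u x} s \<partial>lebesgue) \<partial>lborel)"
    by (intro nn_integral_mono level)
  also have "\<dots> = 8 * ?W * (\<integral>\<^sup>+s. (\<integral>\<^sup>+x. g x * indicator {0..<A * u x} s \<partial>lebesgue) \<partial>lborel)"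
    unfolding indicator_def atLeastLessThan_iff by (rule nn_integral_cmult) measurable
  also have "(\<integral>\<^sup>+s. (\<integral>\<^sup>+x. g x * indicator {0..<A * u x} s \<partial>lebesgue) \<partial>lborel)
      = (\<integral>\<^sup>+x. (\<integral>\<^sup>+s. g x * indicator {0..<A * u x} s \<partial>lborel) \<partial>lebesgue)"
    unfolding indicator_def atLeastLessThan_iff by (rule P.Fubini'[symmetric]) measurable
  also have "\<dots> = (\<integral>\<^sup>+x. A1_const u * (g x * ennreal (u x)) \<partial>lebesgue)"
  proof (rule nn_integral_cong)
    fix x
    have "(\<integral>\<^sup>+s. g x * indicator {0..<A * u x} s \<partial>lborel) = g x * ennreal (A * u x)"
      using A(2) u0[of x] by (subst nn_integral_cmult_indicator) simp_all
    also have "\<dots> = A1_const u * (g x * ennreal (u x))"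
      unfolding A(1) ennreal_mult[OF A(2) u0] by (simp only: ac_simps)
    finally show "(\<integral>\<^sup>+s. g x * indicator {0..<A * u x} s \<partial>lborel) = A1_const u * (g x * ennreal (u x))" .
  qed
  also have "\<dots> = A1_const u * (\<integral>\<^sup>+x. g x * ennreal (u x) \<partial>lebesgue)"
    by (rule nn_integral_cmult) measurable
  finally show ?thesis by (simp only: mult.assoc)
qed

section \<open>Small sets and the Fujii--Wilson constant\<close>

lemma sum_pow_levels_le:
  assumes "finite K" "\<And>k. k \<in> K \<Longrightarrow> 2 ^ k * c \<le> (h :: ennreal)"
  shows "(\<Sum>k\<in>K. 2 ^ k * c) \<le> 2 * h"
proof -
  have eq: "ennreal (2 powi int k) = 2 ^ k" for k by (simp add: ennreal_numeral_power)
  have "(\<Sum>k\<in>int ` K. ennreal (2 powi k) * c) \<le> 2 * h"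
    using assms by (intro sum_levels_le) (auto simp: eq ennreal_numeral_power)
  also have "(\<Sum>k\<in>int ` K. ennreal (2 powi k) * c) = (\<Sum>k\<in>K. 2 ^ k * c)"
    by (subst sum.reindex) (simp_all add: ennreal_numeral_power)
  finally show ?thesis .
qed

text \<open>Applying the Fujii--Wilson condition to the maximal cells of \<open>\<Omega> j\<close> bounds the sum of \<open>u(\<Omega> k)\<close> over \<open>k \<ge> j\<close> by
  a multiple \<open>N / 2\<close> of \<open>u(\<Omega> j)\<close>; as \<open>u(\<Omega> k)\<close> decreases in \<open>k\<close>, it halves after \<open>N\<close> steps.\<close>

lemma grid_max_level_decay:
  fixes u :: "real ^ 'n \<Rightarrow> real"
  assumes u: "weight u" and T: "finite T" "T \<subseteq> grid \<alpha>" and Q: "Q \<in> T" "\<And>R. R \<in> T \<Longrightarrow> R \<subseteq> Q"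
    and parent: "\<And>J. J \<in> T \<Longrightarrow> J \<noteq> Q \<Longrightarrow> \<exists>P\<in>T. J \<subset> P \<and> emeasure lebesgue P = 3 ^ CARD('n) * emeasure lebesgue J"
    and N: "4 * 3 ^ CARD('n) * Ainf_const u \<le> of_nat N" "0 < N"
  defines "a \<equiv> average Q (\<lambda>x. ennreal (u x))"
  defines "\<Omega> \<equiv> \<lambda>k. \<Union>{R \<in> T. 2 ^ k * a < average R (\<lambda>x. ennreal (u x))}"
  shows "2 ^ i * emeasure (wmeas u) (\<Omega> (i * N)) \<le> emeasure (wmeas u) Q"
proof -
  let ?av = "\<lambda>R. average R (\<lambda>x. ennreal (u x))"
  let ?gm = "grid_max T (\<lambda>x. ennreal (u x))"
  let ?W = "Ainf_const u"
  define L where "L = (\<lambda>k::nat. {R \<in> T. 2 ^ k * a < ?av R})"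
  have L: "finite (L k)" "L k \<subseteq> grid \<alpha>" "L k \<subseteq> T" for k using T by (auto simp: L_def)
  have \<Omega>L: "\<Omega> k = \<Union>(L k)" for k by (simp add: \<Omega>_def L_def)
  have \<Omega>s[measurable]: "\<Omega> k \<in> sets lebesgue" for k
    unfolding \<Omega>L using L[of k] sets_grid by (intro sets.finite_Union) auto
  have dec: "\<Omega> k \<subseteq> \<Omega> j" if "j \<le> k" for j k
  proof -
    have "2 ^ j * a \<le> 2 ^ k * a" using that by (intro mult_right_mono power_increasing) auto
    then have "L k \<subseteq> L j" unfolding L_def by (auto intro: le_less_trans)
    then show ?thesis unfolding \<Omega>L by blast
  qed
  have gmm[measurable]: "?gm \<in> borel_measurable lebesgue" by (rule measurable_grid_max[OF T])
  \<comment> \<open>A maximal cell \<open>J\<close> of \<open>L k\<close> is not \<open>Q\<close>,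
    whose average is \<open>a\<close> itself. Its parent lies in \<open>T\<close> but not in
    \<open>L k\<close>, so the parent has average at most 2^k a; passing from \<open>J\<close> to
    the parent costs 3^n in volume.\<close>
  have up: "emeasure (wmeas u) (\<Omega> k) \<le> 3 ^ CARD('n) * (2 ^ k * a * emeasure lebesgue (\<Omega> k))" for k
  proof -
    have "emeasure (wmeas u) (\<Omega> k) = (\<Sum>J\<in>tops (L k). emeasure (wmeas u) J)"
      unfolding \<Omega>L by (rule emeasure_Union_tops[OF L(1,2)]) simp
    also have "\<dots> \<le> (\<Sum>J\<in>tops (L k). 3 ^ CARD('n) * (2 ^ k * a * emeasure lebesgue J))"
    proof (rule sum_mono)
      fix J assume J: "J \<in> tops (L k)"
      then have JL: "J \<in> L k" using tops_subset by blast
      then have JT: "J \<in> T" using L(3)[of k] by blast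
      have "a \<le> 2 ^ k * a" using mult_right_mono[of 1 "2 ^ k" a] by simp
      then have "J \<noteq> Q" using JL unfolding L_def a_def by auto
      then obtain P where P: "P \<in> T" "J \<subset> P" "emeasure lebesgue P = 3 ^ CARD('n) * emeasure lebesgue J"
        using parent JT by blast
      then have "P \<notin> L k" using J unfolding tops_def by blast
      then have Pa: "?av P \<le> 2 ^ k * a" using P(1) by (auto simp: L_def)
      have Pg: "P \<in> grid \<alpha>" using P T by auto
      have "emeasure (wmeas u) J \<le> emeasure (wmeas u) P"
        using P(2) sets_grid[OF Pg] by (intro emeasure_mono) auto
      also have "\<dots> = ?av P * emeasure lebesgue P" using average_wmeas(2)[OF u Pg] by simp
      also have "\<dots> \<le> 2 ^ k * a * emeasure lebesgue P" using Pa by (rule mult_right_mono) simp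
      also have "\<dots> = 3 ^ CARD('n) * (2 ^ k * a * emeasure lebesgue J)" unfolding P(3) by (simp only: ac_simps)
      finally show "emeasure (wmeas u) J \<le> 3 ^ CARD('n) * (2 ^ k * a * emeasure lebesgue J)" .
    qed
    also have "\<dots> = 3 ^ CARD('n) * (2 ^ k * a * (\<Sum>J\<in>tops (L k). emeasure lebesgue J))"
      by (simp only: sum_distrib_left)
    also have "(\<Sum>J\<in>tops (L k). emeasure lebesgue J) = emeasure lebesgue (\<Omega> k)"
      unfolding \<Omega>L by (rule emeasure_Union_tops[OF L(1,2), symmetric]) simp
    finally show ?thesis .
  qed
  \<comment> \<open>On a maximal cell \<open>J\<close> of \<open>L j\<close> the full and the local
    maximal functions agree: a larger cell of \<open>T\<close> has average at most 2^j a, which is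
    below that of \<open>J\<close>. The Fujii--Wilson condition is then used on each
    \<open>J\<close>.\<close>
  have int: "(\<integral>\<^sup>+x\<in>\<Omega> j. ?gm x \<partial>lebesgue) \<le> ?W * emeasure (wmeas u) (\<Omega> j)" for j
  proof -
    have "(\<integral>\<^sup>+x\<in>\<Omega> j. ?gm x \<partial>lebesgue) = emeasure (density lebesgue ?gm) (\<Omega> j)"
      by (rule emeasure_density[symmetric]) measurable
    also have "\<dots> = (\<Sum>J\<in>tops (L j). emeasure (density lebesgue ?gm) J)"
      unfolding \<Omega>L by (rule emeasure_Union_tops[OF L(1,2)]) simp
    also have "\<dots> \<le> (\<Sum>J\<in>tops (L j). ?W * emeasure (wmeas u) J)"
    proof (rule sum_mono)
      fix J assume J: "J \<in> tops (L j)"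
      then have JL: "J \<in> L j" using tops_subset by blast
      then have JT: "J \<in> T" and Jg: "J \<in> grid \<alpha>" using L(2,3)[of j] by blast+
      have "?gm x \<le> grid_max {R \<in> T. R \<subseteq> J} (\<lambda>x. ennreal (u x)) x" if x: "x \<in> J" for x
        unfolding grid_max_def[of T]
      proof (rule SUP_least)
        fix R assume R: "R \<in> {R \<in> T. x \<in> R}"
        have J_le: "?av J \<le> grid_max {R \<in> T. R \<subseteq> J} (\<lambda>x. ennreal (u x)) x"
          using JT x by (intro grid_max_upper) auto
        have "R \<subseteq> J \<or> J \<subseteq> R" using R x T Jg by (intro grid_laminar[of R \<alpha>]) auto
        then show "?av R \<le> grid_max {R \<in> T. R \<subseteq> J} (\<lambda>x. ennreal (u x)) x"
        proof
          assume "R \<subseteq> J"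
          then show ?thesis using R by (intro grid_max_upper) auto
        next
          assume JR: "J \<subseteq> R"
          show ?thesis
          proof (cases "R \<in> L j")
            case True
            then have "R = J" using J JR unfolding tops_def by blast
            then show ?thesis using J_le by simp
          next
            case False
            then have "?av R \<le> 2 ^ j * a" using R by (auto simp: L_def)
            also have "\<dots> \<le> ?av J" using JL by (auto simp: L_def intro: less_imp_le)
            finally show ?thesis using J_le by (rule order_trans)
          qed
        qed
      qed
      then have "(\<integral>\<^sup>+x\<in>J. ?gm x \<partial>lebesgue) \<le> (\<integral>\<^sup>+x\<in>J. grid_max {R \<in> T. R \<subseteq> J} (\<lambda>x. ennreal (u x)) x \<partial>lebesgue)"
        by (intro nn_integral_mono) (auto simp: indicator_def)
      also have "\<dots> \<le> ?W * emeasure (wmeas u) J" by (rule Ainf_grid[OF u Jg T(2)])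
      finally show "emeasure (density lebesgue ?gm) J \<le> ?W * emeasure (wmeas u) J"
        using emeasure_density[OF gmm sets_grid[OF Jg]] by simp
    qed
    also have "\<dots> = ?W * emeasure (wmeas u) (\<Omega> j)"
      unfolding \<Omega>L sum_distrib_left[symmetric] by (subst emeasure_Union_tops[OF L(1,2)]) simp_all
    finally show ?thesis .
  qed
  \<comment> \<open>If x is in \<open>\<Omega> k\<close> then 2^k a is below the maximal function at
    x, so for each x the sum over k is geometric.\<close>
  have tail: "(\<Sum>k\<in>{j..<j+N}. 2 ^ k * a * emeasure lebesgue (\<Omega> k)) \<le> 2 * (?W * emeasure (wmeas u) (\<Omega> j))" for j
  proof -
    have "(\<Sum>k\<in>{j..<j+N}. 2 ^ k * a * emeasure lebesgue (\<Omega> k)) = (\<Sum>k\<in>{j..<j+N}. \<integral>\<^sup>+x. 2 ^ k * a * indicator (\<Omega> k) x \<partial>lebesgue)"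
      by (intro sum.cong refl nn_integral_cmult_indicator[symmetric]) measurable
    also have "\<dots> = (\<integral>\<^sup>+x. (\<Sum>k\<in>{j..<j+N}. 2 ^ k * a * indicator (\<Omega> k) x) \<partial>lebesgue)"
      by (rule nn_integral_sum[symmetric]) measurable
    also have "\<dots> \<le> (\<integral>\<^sup>+x. 2 * (?gm x * indicator (\<Omega> j) x) \<partial>lebesgue)"
    proof (rule nn_integral_mono)
      fix x
      have "(\<Sum>k\<in>{j..<j+N}. 2 ^ k * a * indicator (\<Omega> k) x) = (\<Sum>k\<in>{k \<in> {j..<j+N}. x \<in> \<Omega> k}. 2 ^ k * a)"
        by (intro sum.mono_neutral_cong_right) (auto simp: indicator_def)
      also have "\<dots> \<le> 2 * (?gm x * indicator (\<Omega> j) x)"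
      proof (rule sum_pow_levels_le)
        fix k assume k: "k \<in> {k \<in> {j..<j+N}. x \<in> \<Omega> k}"
        then obtain R where R: "R \<in> L k" "x \<in> R" unfolding \<Omega>L by auto
        have "2 ^ k * a \<le> ?av R" using R by (auto simp: L_def)
        also have "\<dots> \<le> ?gm x" using R L(3)[of k] by (intro grid_max_upper) auto
        finally show "2 ^ k * a \<le> ?gm x * indicator (\<Omega> j) x"
          using k dec[of j k] by (auto simp: indicator_def)
      qed simp
      finally show "(\<Sum>k\<in>{j..<j+N}. 2 ^ k * a * indicator (\<Omega> k) x) \<le> 2 * (?gm x * indicator (\<Omega> j) x)" .
    qed
    also have "\<dots> = 2 * (\<integral>\<^sup>+x\<in>\<Omega> j. ?gm x \<partial>lebesgue)"
      by (rule nn_integral_cmult) measurable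
    also have "\<dots> \<le> 2 * (?W * emeasure (wmeas u) (\<Omega> j))"
      by (intro mult_left_mono int) simp
    finally show ?thesis .
  qed
  have fin: "emeasure (wmeas u) (\<Omega> k) \<noteq> top" for k
  proof -
    have Qg: "Q \<in> grid \<alpha>" using Q T by auto
    have "\<Omega> k \<subseteq> Q" unfolding \<Omega>L using L Q by blast
    then have "emeasure (wmeas u) (\<Omega> k) \<le> emeasure (wmeas u) Q"
      using sets_grid[OF Qg] by (intro emeasure_mono) auto
    then show ?thesis using wmeas_grid(2)[OF u Qg] by (auto simp: top_unique)
  qed
  \<comment> \<open>Each of the \<open>N\<close> sets dominates \<open>\<Omega> (j + N)\<close>, so
    N u(\<open>\<Omega> (j + N)\<close>) <= 2 * 3^n [u]_{A_infinity} u(\<open>\<Omega> j\<close>).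
    The hypothesis on \<open>N\<close> makes the right side at most (N/2)
    u(\<open>\<Omega> j\<close>), and \<open>N\<close> cancels.\<close>
  have half: "2 * emeasure (wmeas u) (\<Omega> (j + N)) \<le> emeasure (wmeas u) (\<Omega> j)" for j
  proof -
    let ?x = "emeasure (wmeas u) (\<Omega> (j + N))" and ?y = "emeasure (wmeas u) (\<Omega> j)"
    have "of_nat N * ?x = (\<Sum>k\<in>{j..<j+N}. ?x)" by simp
    also have "\<dots> \<le> (\<Sum>k\<in>{j..<j+N}. 3 ^ CARD('n) * (2 ^ k * a * emeasure lebesgue (\<Omega> k)))"
    proof (rule sum_mono)
      fix k assume "k \<in> {j..<j+N}"
      then have "?x \<le> emeasure (wmeas u) (\<Omega> k)" using dec[of k "j + N"] by (intro emeasure_mono) auto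
      also note up
      finally show "?x \<le> 3 ^ CARD('n) * (2 ^ k * a * emeasure lebesgue (\<Omega> k))" .
    qed
    also have "\<dots> = 3 ^ CARD('n) * (\<Sum>k\<in>{j..<j+N}. 2 ^ k * a * emeasure lebesgue (\<Omega> k))"
      by (simp only: sum_distrib_left)
    also have "\<dots> \<le> 3 ^ CARD('n) * (2 * (?W * ?y))"
      by (intro mult_left_mono tail) simp
    finally have "2 * (of_nat N * ?x) \<le> 2 * (3 ^ CARD('n) * (2 * (?W * ?y)))"
      by (rule mult_left_mono) simp
    also have "\<dots> = (2 * 2) * 3 ^ CARD('n) * ?W * ?y" by (simp only: ac_simps)
    also have "\<dots> \<le> of_nat N * ?y" using N(1) by (intro mult_right_mono) auto
    finally have "of_nat N * (2 * ?x) \<le> of_nat N * ?y" by (simp only: ac_simps)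
    moreover have "(of_nat N :: ennreal) \<noteq> 0" using N(2) by simp
    ultimately show ?thesis by (simp add: ennreal_mult_le_mult_iff)
  qed
  show ?thesis
  proof (induction i)
    case 0
    have Qg: "Q \<in> grid \<alpha>" using Q T by auto
    have "\<Omega> 0 \<subseteq> Q" unfolding \<Omega>L using L Q by blast
    then show ?case using sets_grid[OF Qg] by (auto intro!: emeasure_mono)
  next
    case (Suc i)
    have "2 ^ Suc i * emeasure (wmeas u) (\<Omega> (Suc i * N)) = 2 ^ i * (2 * emeasure (wmeas u) (\<Omega> (i * N + N)))"
      by (simp add: ac_simps)
    also have "\<dots> \<le> 2 ^ i * emeasure (wmeas u) (\<Omega> (i * N))"
      by (intro mult_left_mono half) simp
    also note Suc
    finally show ?case .
  qed
qed

text \<open>Split \<open>D\<close> at height 2^(iN) times the average over \<open>Q\<close>. Cells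
  below it carry u-mass at most that height times their volume; cells above it lie in the set whose
  mass \<open>grid_max_level_decay\<close> bounds by 2^(-i) u(Q).\<close>

lemma finite_small_union:
  fixes u :: "real ^ 'n \<Rightarrow> real"
  assumes u: "weight u" and T: "finite T" "T \<subseteq> grid \<alpha>" and Q: "Q \<in> T" "\<And>R. R \<in> T \<Longrightarrow> R \<subseteq> Q"
    and parent: "\<And>J. J \<in> T \<Longrightarrow> J \<noteq> Q \<Longrightarrow> \<exists>P\<in>T. J \<subset> P \<and> emeasure lebesgue P = 3 ^ CARD('n) * emeasure lebesgue J"
    and N: "4 * 3 ^ CARD('n) * Ainf_const u \<le> of_nat N" "0 < N"
    and D: "D \<subseteq> T"
  shows "emeasure (wmeas u) (\<Union>D) \<le> 2 ^ (i * N) * average Q (\<lambda>x. ennreal (u x)) * emeasure lebesgue (\<Union>D)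
    + ennreal ((1 / 2) ^ i) * emeasure (wmeas u) Q"
proof -
  let ?av = "\<lambda>R. average R (\<lambda>x. ennreal (u x))"
  let ?t = "2 ^ (i * N) * ?av Q"
  define L where "L = {R \<in> T. ?t < ?av R}"
  define D' where "D' = {R \<in> D. ?av R \<le> ?t}"
  have D': "finite D'" "D' \<subseteq> grid \<alpha>" "D' \<subseteq> D" using D T by (auto simp: D'_def intro: finite_subset)
  have s: "\<Union>D' \<in> sets lebesgue" "\<Union>L \<in> sets lebesgue" "\<Union>D \<in> sets lebesgue"
    using D D' T sets_grid by (auto simp: L_def intro!: sets.finite_Union intro: finite_subset)
  have "emeasure (wmeas u) (\<Union>D) \<le> emeasure (wmeas u) (\<Union>D' \<union> \<Union>L)"
  proof (rule emeasure_mono)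
    have "D \<subseteq> D' \<union> L" using D by (auto simp: D'_def L_def not_le)
    then show "\<Union>D \<subseteq> \<Union>D' \<union> \<Union>L" by blast
    show "\<Union>D' \<union> \<Union>L \<in> sets (wmeas u)" using s by simp
  qed
  also have "\<dots> \<le> emeasure (wmeas u) (\<Union>D') + emeasure (wmeas u) (\<Union>L)"
    using s by (intro emeasure_subadditive) auto
  also have "emeasure (wmeas u) (\<Union>D') \<le> ?t * emeasure lebesgue (\<Union>D)"
  proof -
    have "emeasure (wmeas u) (\<Union>D') = (\<Sum>R\<in>tops D'. emeasure (wmeas u) R)"
      by (rule emeasure_Union_tops[OF D'(1,2)]) simp
    also have "\<dots> \<le> (\<Sum>R\<in>tops D'. ?t * emeasure lebesgue R)"
    proof (rule sum_mono)
      fix R assume "R \<in> tops D'"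
      then have R: "R \<in> grid \<alpha>" "?av R \<le> ?t" using tops_subset[of D'] D' by (auto simp: D'_def)
      show "emeasure (wmeas u) R \<le> ?t * emeasure lebesgue R"
        unfolding average_wmeas(2)[OF u R(1), symmetric] using R(2) by (rule mult_right_mono) simp
    qed
    also have "\<dots> = ?t * emeasure lebesgue (\<Union>D')"
      unfolding sum_distrib_left[symmetric] by (subst emeasure_Union_tops[OF D'(1,2)]) simp_all
    also have "\<dots> \<le> ?t * emeasure lebesgue (\<Union>D)"
      using s D' by (intro mult_left_mono emeasure_mono Union_mono) auto
    finally show ?thesis .
  qed
  also have "emeasure (wmeas u) (\<Union>L) \<le> ennreal ((1 / 2) ^ i) * emeasure (wmeas u) Q"
  proof -
    have "ennreal ((1 / 2) ^ i) * 2 ^ i = 1"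
      by (simp flip: ennreal_numeral_power ennreal_mult power_mult_distrib)
    then have "emeasure (wmeas u) (\<Union>L) = ennreal ((1 / 2) ^ i) * (2 ^ i * emeasure (wmeas u) (\<Union>L))"
      by (simp flip: mult.assoc)
    also have "\<dots> \<le> ennreal ((1 / 2) ^ i) * emeasure (wmeas u) Q"
      using grid_max_level_decay[OF u T Q parent N, of i] unfolding L_def by (intro mult_left_mono) auto
    finally show ?thesis .
  qed
  finally show ?thesis by (auto intro: add_mono)
qed

section \<open>From finite unions of cells to measurable sets\<close>

lemma finite_cells:
  assumes "bounded S"
  shows "finite (cell_at \<alpha> k ` (S :: (real ^ 'n) set))"
proof -
  obtain B where B: "\<And>x. x \<in> S \<Longrightarrow> norm x \<le> B" using assms by (auto simp: bounded_iff)
  define D where "D = 3 powi k * B + 1"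
  have "cell_at \<alpha> k ` S \<subseteq> tcell \<alpha> k ` (PiE UNIV (\<lambda>_. {\<lfloor>- D\<rfloor>..\<lfloor>D\<rfloor>}))"
  proof (rule image_subsetI)
    fix x assume "x \<in> S"
    have "\<lfloor>- D\<rfloor> \<le> \<lfloor>3 powi k * x $ i - of_bool (\<alpha> i) / 2\<rfloor> \<and> \<lfloor>3 powi k * x $ i - of_bool (\<alpha> i) / 2\<rfloor> \<le> \<lfloor>D\<rfloor>" for i
    proof -
      have "\<bar>x $ i\<bar> \<le> B" using B[OF \<open>x \<in> S\<close>] component_le_norm_cart[of x i] by linarith
      then have "\<bar>3 powi k * x $ i\<bar> \<le> 3 powi k * B" by (simp add: abs_mult mult_left_mono)
      moreover have "0 \<le> of_bool (\<alpha> i) / (2::real)" "of_bool (\<alpha> i) / (2::real) \<le> 1" by auto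
      ultimately have "- D \<le> 3 powi k * x $ i - of_bool (\<alpha> i) / 2" "3 powi k * x $ i - of_bool (\<alpha> i) / 2 \<le> D"
        unfolding D_def by linarith+
      then show ?thesis by (intro conjI floor_mono)
    qed
    then show "cell_at \<alpha> k x \<in> tcell \<alpha> k ` (PiE UNIV (\<lambda>_. {\<lfloor>- D\<rfloor>..\<lfloor>D\<rfloor>}))"
      unfolding cell_at_def by (intro imageI) (simp add: PiE_UNIV_domain)
  qed
  moreover have "finite (PiE (UNIV :: 'n set) (\<lambda>_. {\<lfloor>- D\<rfloor>..\<lfloor>D\<rfloor>}))"
    by (rule finite_PiE) auto
  ultimately show ?thesis using finite_subset finite_imageI by metis
qed

lemma cell_at_in_open:
  assumes "open U" "(x :: real ^ 'n) \<in> U"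
  shows "\<exists>M::nat. cell_at \<alpha> (k + int M) x \<subseteq> U"
proof -
  obtain r where r: "0 < r" "ball x r \<subseteq> U" using assms open_contains_ball by blast
  \<comment> \<open>By the l1 norm, points of a cell of generation \<open>k + int M\<close> are
    within n 3^(-k-M) of each other; \<open>c\<close> is the value below which 3^(-M) makes this
    less than \<open>r\<close>.\<close>
  define c where "c = r / (real CARD('n) * 3 powi (- k))"
  have c: "0 < c" using r by (simp add: c_def)
  obtain M where M: "(1 / 3) ^ M < c" using real_arch_pow_inv[OF c, of "1 / 3"] by auto
  have pM: "3 powi (- (k + int M)) = 3 powi (- k) * (1 / 3 :: real) ^ M"
  proof -
    have "3 powi (- k + - int M) = 3 powi (- k) * (3 powi (- int M) :: real)"
      by (rule power_int_add) simp
    also have "(3 powi (- int M) :: real) = (1 / 3) ^ M"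
      unfolding power_int_minus power_int_of_nat by (simp add: power_one_over inverse_eq_divide)
    finally show ?thesis by simp
  qed
  have "cell_at \<alpha> (k + int M) x \<subseteq> ball x r"
  proof
    fix y assume y: "y \<in> cell_at \<alpha> (k + int M) x"
    have comp: "\<bar>(x - y) $ i\<bar> \<le> 3 powi (- (k + int M))" for i
    proof -
      let ?s = "3 powi (k + int M) :: real"
      have s: "0 < ?s" by simp
      have "\<lfloor>?s * y $ i - of_bool (\<alpha> i) / 2\<rfloor> = \<lfloor>?s * x $ i - of_bool (\<alpha> i) / 2\<rfloor>"
        using y unfolding cell_at_def tcell_def by blast
      then have "\<bar>?s * x $ i - ?s * y $ i\<bar> \<le> 1" by linarith
      then have "?s * \<bar>x $ i - y $ i\<bar> \<le> 1" using s by (simp add: abs_mult flip: right_diff_distrib)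
      then show ?thesis using s unfolding power_int_minus[of 3 "k + int M"] by (simp add: field_simps)
    qed
    have "norm (x - y) \<le> (\<Sum>i\<in>UNIV. \<bar>(x - y) $ i\<bar>)" by (rule norm_le_l1_cart)
    also have "\<dots> \<le> (\<Sum>i\<in>(UNIV :: 'n set). 3 powi (- (k + int M)))" by (intro sum_mono comp)
    also have "\<dots> = real CARD('n) * 3 powi (- k) * (1 / 3) ^ M" unfolding pM by simp
    also have "\<dots> < r" using M r by (simp add: c_def field_simps)
    finally show "y \<in> ball x r" by (simp add: dist_norm)
  qed
  then show ?thesis using r by blast
qed

lemma cell_at_cong: "y \<in> cell_at \<alpha> k x \<Longrightarrow> cell_at \<alpha> k y = cell_at \<alpha> k x"
  unfolding cell_at_def[of \<alpha> k x] by (rule cell_at_eq)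

text \<open>Approximating \<open>E\<close> from outside by open sets, which are increasing unions of finite unions of cells,
  avoids the Lebesgue differentiation theorem.\<close>

lemma wmeas_small_set:
  fixes u :: "real ^ 'n \<Rightarrow> real"
  assumes u: "weight u" and N: "4 * 3 ^ CARD('n) * Ainf_const u \<le> of_nat N" "0 < N"
    and Q: "Q \<in> grid \<alpha>" and E: "E \<in> sets lebesgue" "E \<subseteq> Q"
    and \<epsilon>: "emeasure lebesgue E \<le> ennreal \<epsilon> * emeasure lebesgue Q" "0 \<le> \<epsilon>"
  shows "emeasure (wmeas u) E \<le> ennreal (2 ^ (i * N) * \<epsilon> + (1 / 2) ^ i) * emeasure (wmeas u) Q"
proof -
  let ?a = "average Q (\<lambda>x. ennreal (u x))"
  let ?t = "2 ^ (i * N) * ?a"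
  let ?c = "ennreal ((1 / 2) ^ i) * emeasure (wmeas u) Q"
  obtain k0 x0 where Q0: "Q = cell_at \<alpha> k0 x0" using Q by (rule grid_obtains)
  have Qk0: "cell_at \<alpha> k0 y = Q" if "y \<in> Q" for y
    using cell_at_cong that unfolding Q0 by blast
  define T where "T = (\<lambda>M::nat. \<Union>k\<in>{k0..k0 + int M}. cell_at \<alpha> k ` Q)"
  have "bounded Q" using grid_bounded_compact[OF Q] by (metis bounded_subset compact_imp_bounded)
  then have T: "finite (T M)" "T M \<subseteq> grid \<alpha>" for M
    unfolding T_def using finite_cells cell_at_grid by auto
  have "x0 \<in> Q" unfolding Q0 by (rule cell_at_self)
  with Q0 have Qim: "Q \<in> cell_at \<alpha> k0 ` Q" by (rule image_eqI)
  have QT: "Q \<in> T M" for M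
    unfolding T_def by (rule UN_I[of k0]) (simp, rule Qim)
  have TQ: "R \<subseteq> Q" if R: "R \<in> T M" for R M
  proof -
    obtain k y where ky: "k0 \<le> k" "y \<in> Q" "R = cell_at \<alpha> k y" using R unfolding T_def by auto
    show ?thesis using cell_at_mono[OF ky(1), of \<alpha> y] unfolding ky(3) Qk0[OF ky(2)] .
  qed
  have parent: "\<exists>P\<in>T M. J \<subset> P \<and> emeasure lebesgue P = 3 ^ CARD('n) * emeasure lebesgue J"
    if J: "J \<in> T M" "J \<noteq> Q" for J M
  proof -
    obtain k y where ky: "k0 \<le> k" "k \<le> k0 + int M" "y \<in> Q" "J = cell_at \<alpha> k y" using J(1) unfolding T_def by auto
    have "k \<noteq> k0" using J(2) Qk0[OF ky(3)] ky(4) by blast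
    then have k: "k - 1 \<in> {k0..k0 + int M}" using ky by auto
    let ?P = "cell_at \<alpha> (k - 1) y"
    have m: "emeasure lebesgue ?P = 3 ^ CARD('n) * emeasure lebesgue J"
      using cell_at_parent_measure[of \<alpha> "k - 1" y] ky(4) by simp
    \<comment> \<open>As sets, a cell and its parent could only coincide if their volumes did, but
      these are positive, finite and differ by the factor 3^n > 1.\<close>
    have "?P \<noteq> J"
    proof
      assume "?P = J"
      then have eq: "emeasure lebesgue J = 3 ^ CARD('n) * emeasure lebesgue J" using m by simp
      define r where "r = (3 powi (- k) :: real) ^ CARD('n)"
      have r: "0 < r" by (simp add: r_def)
      have "ennreal r = ennreal (3 ^ CARD('n)) * ennreal r"
        using eq unfolding ky(4) emeasure_cell_at r_def[symmetric] ennreal_numeral_power .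
      then have "ennreal r = ennreal (3 ^ CARD('n) * r)" using r by (simp add: ennreal_mult)
      then have "r = 3 ^ CARD('n) * r" using r by simp
      then have "(3::real) ^ CARD('n) = 1" using r by simp
      moreover have "(1::real) < 3 ^ CARD('n)" by (rule one_less_power) auto
      ultimately show False by simp
    qed
    moreover have "J \<subseteq> ?P" using cell_at_mono_Suc[of \<alpha> "k - 1" y] ky(4) by simp
    moreover have "?P \<in> T M" unfolding T_def using k ky(3) by blast
    ultimately show ?thesis using m by blast
  qed
  have op: "emeasure (wmeas u) E \<le> ?t * emeasure lebesgue (Q \<inter> U) + ?c" if U: "open U" "E \<subseteq> U" for U
  proof -
    define D where "D = (\<lambda>M. {R \<in> T M. R \<subseteq> U})"
    have Us: "Q \<inter> U \<in> sets lebesgue" using U(1) sets_grid[OF Q] by auto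
    have Ds: "\<Union>(D M) \<in> sets lebesgue" for M
    proof (rule sets.finite_Union)
      show "finite (D M)" using T(1)[of M] by (simp add: D_def)
      show "D M \<subseteq> sets lebesgue"
      proof
        fix R assume "R \<in> D M"
        then have "R \<in> grid \<alpha>" using T(2)[of M] by (auto simp: D_def)
        then show "R \<in> sets lebesgue" by (rule sets_grid)
      qed
    qed
    have DQ: "\<Union>(D M) \<subseteq> Q \<inter> U" for M using TQ unfolding D_def by blast
    \<comment> \<open>Around each point of the open set a sufficiently deep cell fits inside
      \<open>U\<close>, so the finite unions exhaust \<open>Q \<inter> U\<close>.\<close>
    have "Q \<inter> U \<subseteq> (\<Union>M. \<Union>(D M))"
    proof
      fix x assume x: "x \<in> Q \<inter> U"
      then obtain M where M: "cell_at \<alpha> (k0 + int M) x \<subseteq> U" using cell_at_in_open[OF U(1)] by blast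
      have "cell_at \<alpha> (k0 + int M) x \<in> T M" unfolding T_def using x by auto
      then have "cell_at \<alpha> (k0 + int M) x \<in> D M" using M by (simp add: D_def)
      then show "x \<in> (\<Union>M. \<Union>(D M))" using cell_at_self by blast
    qed
    then have QU: "Q \<inter> U = (\<Union>M. \<Union>(D M))" using DQ by blast
    have inc: "incseq (\<lambda>M. \<Union>(D M))"
    proof (rule incseq_SucI)
      fix M
      have "T M \<subseteq> T (Suc M)" unfolding T_def by (intro UN_mono) auto
      then show "\<Union>(D M) \<subseteq> \<Union>(D (Suc M))" unfolding D_def by blast
    qed
    have "emeasure (wmeas u) E \<le> emeasure (wmeas u) (Q \<inter> U)"
      using E U Us by (intro emeasure_mono) auto
    also have "\<dots> = (SUP M. emeasure (wmeas u) (\<Union>(D M)))"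
      unfolding QU using Ds inc by (intro SUP_emeasure_incseq[symmetric]) auto
    also have "\<dots> \<le> ?t * emeasure lebesgue (Q \<inter> U) + ?c"
    proof (rule SUP_least)
      fix M
      have "emeasure (wmeas u) (\<Union>(D M)) \<le> ?t * emeasure lebesgue (\<Union>(D M)) + ?c"
      proof (rule finite_small_union[OF u T QT TQ parent N])
        show "D M \<subseteq> T M" by (auto simp: D_def)
      qed
      also have "\<dots> \<le> ?t * emeasure lebesgue (Q \<inter> U) + ?c"
        using DQ Us by (intro add_right_mono mult_left_mono emeasure_mono) auto
      finally show "emeasure (wmeas u) (\<Union>(D M)) \<le> ?t * emeasure lebesgue (Q \<inter> U) + ?c" .
    qed
    finally show ?thesis .
  qed
  define K where "K = enn2real ?t"
  have K: "?t = ennreal K" "0 \<le> K"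
    using average_wmeas(4)[OF u Q] by (auto simp: K_def less_top ennreal_mult_less_top power_less_top_ennreal)
  have "emeasure (wmeas u) E \<le> ?t * emeasure lebesgue E + ?c"
  proof (rule ennreal_le_epsilon)
    fix e :: real assume e: "0 < e"
    \<comment> \<open>The \<open>+ 1\<close> gives K e' <= e without knowing that \<open>K\<close>
      is positive.\<close>
    define e' where "e' = e / (K + 1)"
    have e': "0 < e'" "K * e' \<le> e" using e K(2) by (auto simp: e'_def field_simps)
    obtain U where U: "open U" "E \<subseteq> U" "U - E \<in> lmeasurable" "emeasure lebesgue (U - E) < ennreal e'"
      using sets_lebesgue_outer_open[OF E(1) e'(1)] .
    have "emeasure lebesgue (Q \<inter> U) \<le> emeasure lebesgue (E \<union> (U - E))"
      using E(1) U(3) by (intro emeasure_mono sets.Un) (auto dest: fmeasurableD)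
    also have "\<dots> \<le> emeasure lebesgue E + emeasure lebesgue (U - E)"
      using E(1) U(3) by (intro emeasure_subadditive) (auto dest: fmeasurableD)
    also have "\<dots> \<le> emeasure lebesgue E + ennreal e'" using U(4) by (intro add_left_mono less_imp_le)
    finally have "?t * emeasure lebesgue (Q \<inter> U) \<le> ?t * (emeasure lebesgue E + ennreal e')"
      by (rule mult_left_mono) simp
    also have "\<dots> = ?t * emeasure lebesgue E + ennreal (K * e')"
      unfolding distrib_left using K e'(1) by (simp add: ennreal_mult)
    also have "\<dots> \<le> ?t * emeasure lebesgue E + ennreal e" using e'(2) by (intro add_left_mono ennreal_leI)
    finally have "?t * emeasure lebesgue (Q \<inter> U) + ?c \<le> ?t * emeasure lebesgue E + ennreal e + ?c" by (rule add_right_mono)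
    from order_trans[OF op[OF U(1,2)] this]
    show "emeasure (wmeas u) E \<le> ?t * emeasure lebesgue E + ?c + ennreal e"
      by (simp only: ac_simps)
  qed
  also have "?t * emeasure lebesgue E \<le> ?t * (ennreal \<epsilon> * emeasure lebesgue Q)"
    by (intro mult_left_mono \<epsilon>(1)) simp
  also have "\<dots> = (2 ^ (i * N) * ennreal \<epsilon>) * (?a * emeasure lebesgue Q)" by (simp only: ac_simps)
  also have "\<dots> = ennreal (2 ^ (i * N) * \<epsilon>) * emeasure (wmeas u) Q"
    unfolding average_wmeas(2)[OF u Q] using \<epsilon>(2) by (simp add: ennreal_mult ennreal_numeral_power)
  finally have "emeasure (wmeas u) E \<le> ennreal (2 ^ (i * N) * \<epsilon>) * emeasure (wmeas u) Q + ?c"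
    by (simp add: add_right_mono)
  then show ?thesis using \<epsilon>(2) by (simp add: ennreal_plus distrib_right)
qed

section \<open>Level sets\<close>

text \<open>The exponent i = \<open>q div (2 * N)\<close> makes 2^(iN) 2^(-q) <= 2^(-iN) <= 2^(-i),
  so both terms of \<open>wmeas_small_set\<close> are at most 2^(-i). Since \<open>N\<close> is of
  the order of [u]_{A_infinity}, this is the geometric decay rate that enters the final
  bound.\<close>

lemma wmeas_small_set_dyadic:
  fixes u :: "real ^ 'n \<Rightarrow> real"
  assumes u: "weight u" and N: "4 * 3 ^ CARD('n) * Ainf_const u \<le> of_nat N" "0 < N"
    and Q: "Q \<in> grid \<alpha>" and E: "E \<in> sets lebesgue" "E \<subseteq> Q"
    and q: "emeasure lebesgue E \<le> ennreal ((1 / 2) ^ q) * emeasure lebesgue Q"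
  shows "emeasure (wmeas u) E \<le> ennreal (2 * (1 / 2) ^ (q div (2 * N))) * emeasure (wmeas u) Q"
proof -
  define i where "i = q div (2 * N)"
  have "2 * (i * N) \<le> q" using div_times_less_eq_dividend[of q "2 * N"] by (simp add: i_def ac_simps)
  then have "(1 / 2 :: real) ^ q \<le> (1 / 2) ^ (i * N + i * N)" by (intro power_decreasing) auto
  then have "2 ^ (i * N) * (1 / 2 :: real) ^ q \<le> 2 ^ (i * N) * (1 / 2) ^ (i * N + i * N)" by (rule mult_left_mono) simp
  also have "\<dots> = (1 / 2) ^ (i * N)" unfolding power_add by (simp add: power_one_over)
  also have "\<dots> \<le> (1 / 2) ^ i" using N(2) by (intro power_decreasing) auto
  finally have "2 ^ (i * N) * (1 / 2 :: real) ^ q + (1 / 2) ^ i \<le> 2 * (1 / 2) ^ i" by simp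
  then have "ennreal (2 ^ (i * N) * (1 / 2) ^ q + (1 / 2) ^ i) * emeasure (wmeas u) Q \<le> ennreal (2 * (1 / 2) ^ i) * emeasure (wmeas u) Q"
    by (intro mult_right_mono ennreal_leI) auto
  moreover have "emeasure (wmeas u) E \<le> ennreal (2 ^ (i * N) * (1 / 2) ^ q + (1 / 2) ^ i) * emeasure (wmeas u) Q"
    by (rule wmeas_small_set[OF u N Q E q]) simp
  ultimately show ?thesis unfolding i_def by (rule order_trans[rotated])
qed

text \<open>The exponent is constant on blocks of length \<open>P\<close>, so the series is
  \<open>P\<close> copies of one of sum 2.\<close>

lemma suminf_half_div:
  assumes "0 < P"
  shows "(\<Sum>i. ennreal ((1 / 2) ^ (i div P))) \<le> 2 * of_nat P"
proof (rule suminf_le_const[OF summableI])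
  fix M
  have geo: "(\<Sum>j<m. (1 / 2 :: real) ^ j) \<le> 2" for m
    by (subst geometric_sum) (auto simp: field_simps)
  have blocks: "(\<Sum>i<m * P. (1 / 2 :: real) ^ (i div P)) = real P * (\<Sum>j<m. (1 / 2) ^ j)" for m
  proof -
    have "(\<Sum>i<m * P. (1 / 2 :: real) ^ (i div P)) = (\<Sum>j<m. \<Sum>i\<in>{j * P..<j * P + P}. (1 / 2) ^ (i div P))"
      by (rule sum.nat_group[symmetric])
    also have "\<dots> = (\<Sum>j<m. \<Sum>i\<in>{j * P..<j * P + P}. (1 / 2) ^ j)"
    proof (intro sum.cong refl)
      fix j i assume "i \<in> {j * P..<j * P + P}"
      then have "i div P = j" by (intro div_nat_eqI) (auto simp: ac_simps)
      then show "(1 / 2 :: real) ^ (i div P) = (1 / 2) ^ j" by simp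
    qed
    finally show ?thesis by (simp add: sum_distrib_left)
  qed
  have "(\<Sum>i<M. (1 / 2 :: real) ^ (i div P)) \<le> (\<Sum>i<M * P. (1 / 2) ^ (i div P))"
    using assms by (intro sum_mono2) auto
  also have "\<dots> \<le> real P * 2" unfolding blocks by (intro mult_left_mono geo) simp
  finally have "ennreal (\<Sum>i<M. (1 / 2 :: real) ^ (i div P)) \<le> ennreal (real P * 2)" by (rule ennreal_leI)
  also have "\<dots> = 2 * of_nat P" by (simp add: ennreal_mult ennreal_of_nat_eq_real_of_nat mult.commute)
  also have "ennreal (\<Sum>i<M. (1 / 2 :: real) ^ (i div P)) = (\<Sum>i<M. ennreal ((1 / 2) ^ (i div P)))"
    by (rule sum_ennreal[symmetric]) simp
  finally show "(\<Sum>i<M. ennreal ((1 / 2) ^ (i div P))) \<le> 2 * of_nat P" .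
qed

text \<open>Subtraction on naturals is truncated, so the first \<open>L\<close> terms are 1; these
  are the exceptional levels that cost log [v]_{A_p}.\<close>

lemma suminf_half_div_shift:
  assumes "0 < P"
  shows "(\<Sum>i. ennreal ((1 / 2) ^ ((i - L) div P))) \<le> of_nat L + 2 * of_nat P"
proof -
  have "(\<Sum>i. ennreal ((1 / 2) ^ ((i - L) div P)))
      = (\<Sum>i. ennreal ((1 / 2) ^ ((i + L - L) div P))) + (\<Sum>i<L. ennreal ((1 / 2) ^ ((i - L) div P)))"
    by (rule suminf_offset[OF summableI])
  also have "\<dots> = (\<Sum>i. ennreal ((1 / 2) ^ (i div P))) + of_nat L" by simp
  also have "\<dots> \<le> 2 * of_nat P + of_nat L"
    by (rule add_right_mono[OF suminf_half_div[OF assms]])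
  finally show ?thesis by (simp only: add.commute)
qed

text \<open>On the slice of \<open>I\<close>, \<open>v\<close> is at most twice the threshold, so
  its uv-mass is at most 2 \<theta> times the threshold times u(I). Then \<open>level_sum\<close>
  applies, and 16 = 2 * 8.\<close>

lemma level_measure:
  fixes g :: "real ^ 'n \<Rightarrow> ennreal" and m :: int
  assumes v: "weight v" and u: "weight u" "A1_const u < top"
    and \<F>: "finite \<F>" "\<F> \<subseteq> grid \<alpha>" and g: "g \<in> borel_measurable lebesgue"
    and \<theta>: "\<And>I. I \<in> \<F> \<Longrightarrow> emeasure (wmeas u) {x \<in> I. 2 powi (avg_level v I + m) < v x \<and> v x \<le> 2 powi (avg_level v I + m + 1)}
       \<le> ennreal \<theta> * emeasure (wmeas u) I"
  shows "emeasure (uv_measure u v) (\<Union>I\<in>{I \<in> \<F>. I \<in> stop_cubes \<F> g (ennreal (2 powi (avg_level v I + m)))}.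
      {x \<in> I. 2 powi (avg_level v I + m) < v x \<and> v x \<le> 2 powi (avg_level v I + m + 1)})
    \<le> 16 * Ainf_const v * A1_const u * (\<integral>\<^sup>+x. g x * ennreal (u x) \<partial>lebesgue) * ennreal \<theta>"
proof -
  let ?X = "\<integral>\<^sup>+x. g x * ennreal (u x) \<partial>lebesgue"
  define \<Gamma> where "\<Gamma> = {I \<in> \<F>. I \<in> stop_cubes \<F> g (ennreal (2 powi (avg_level v I + m)))}"
  define E where "E = (\<lambda>I. {x \<in> I. 2 powi (avg_level v I + m) < v x \<and> v x \<le> 2 powi (avg_level v I + m + 1)})"
  have um[measurable]: "u \<in> borel_measurable lebesgue" and u0: "\<And>x. 0 \<le> u x"
    and vm[measurable]: "v \<in> borel_measurable lebesgue" and v0: "\<And>x. 0 \<le> v x"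
    using u v by (auto simp: weight_def)
  have \<Gamma>: "finite \<Gamma>" "\<Gamma> \<subseteq> \<F>" using \<F> by (auto simp: \<Gamma>_def)
  have Es: "E I \<in> sets lebesgue" if "I \<in> \<Gamma>" for I
  proof -
    have [measurable]: "I \<in> sets lebesgue" using that \<Gamma> \<F> sets_grid[of I \<alpha>] by blast
    have "E I = I \<inter> {x \<in> space lebesgue. 2 powi (avg_level v I + m) < v x \<and> v x \<le> 2 powi (avg_level v I + m + 1)}"
      by (auto simp: E_def)
    also have "\<dots> \<in> sets lebesgue" by measurable
    finally show ?thesis .
  qed
  have uvE: "emeasure (uv_measure u v) (E I) \<le> 2 * ennreal \<theta> * (ennreal (2 powi (avg_level v I + m)) * emeasure (wmeas u) I)"
    if I: "I \<in> \<Gamma>" for I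
  proof -
    have "emeasure (uv_measure u v) (E I) = (\<integral>\<^sup>+x. ennreal (u x * v x) * indicator (E I) x \<partial>lebesgue)"
      unfolding uv_measure_def using Es[OF I] by (intro emeasure_density) auto
    also have "\<dots> \<le> (\<integral>\<^sup>+x. ennreal (2 powi (avg_level v I + m + 1)) * (ennreal (u x) * indicator (E I) x) \<partial>lebesgue)"
    proof (rule nn_integral_mono)
      fix x
      show "ennreal (u x * v x) * indicator (E I) x \<le> ennreal (2 powi (avg_level v I + m + 1)) * (ennreal (u x) * indicator (E I) x)"
      proof (cases "x \<in> E I")
        case True
        then have "u x * v x \<le> 2 powi (avg_level v I + m + 1) * u x"
          using u0[of x] by (subst mult.commute) (auto simp: E_def intro!: mult_right_mono)
        then have "ennreal (u x * v x) \<le> ennreal (2 powi (avg_level v I + m + 1) * u x)" by (rule ennreal_leI)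
        also have "\<dots> = ennreal (2 powi (avg_level v I + m + 1)) * ennreal (u x)"
          using u0 by (intro ennreal_mult) auto
        finally show ?thesis using True by simp
      qed simp
    qed
    also have "\<dots> = ennreal (2 powi (avg_level v I + m + 1)) * (\<integral>\<^sup>+x. ennreal (u x) * indicator (E I) x \<partial>lebesgue)"
      using Es[OF I] by (intro nn_integral_cmult borel_measurable_times_ennreal borel_measurable_indicator) auto
    also have "\<dots> = ennreal (2 powi (avg_level v I + m + 1)) * emeasure (wmeas u) (E I)"
      unfolding emeasure_wmeas[OF u(1) Es[OF I]] ..
    also have "\<dots> \<le> ennreal (2 powi (avg_level v I + m + 1)) * (ennreal \<theta> * emeasure (wmeas u) I)"
      using \<theta>[of I] I \<Gamma> unfolding E_def by (intro mult_left_mono) auto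
    also have "ennreal (2 powi (avg_level v I + m + 1)) = 2 * ennreal (2 powi (avg_level v I + m))"
      using ennreal_powi_Suc[of "avg_level v I + m + 1"] by simp
    finally show ?thesis by (simp only: ac_simps)
  qed
  have "emeasure (uv_measure u v) (\<Union>I\<in>\<Gamma>. E I) \<le> (\<Sum>I\<in>\<Gamma>. emeasure (uv_measure u v) (E I))"
    using \<Gamma>(1) Es by (intro emeasure_subadditive_finite) (auto simp: uv_measure_def)
  also have "\<dots> \<le> (\<Sum>I\<in>\<Gamma>. 2 * ennreal \<theta> * (ennreal (2 powi (avg_level v I + m)) * emeasure (wmeas u) I))"
    by (rule sum_mono[OF uvE])
  also have "\<dots> = 2 * ennreal \<theta> * (\<Sum>I\<in>\<Gamma>. ennreal (2 powi (avg_level v I + m)) * emeasure (wmeas u) I)"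
    by (rule sum_distrib_left[symmetric])
  also have "\<dots> \<le> 2 * ennreal \<theta> * (8 * Ainf_const v * A1_const u * ?X)"
    unfolding \<Gamma>_def by (intro mult_left_mono level_sum[OF v u \<F> g]) simp
  also have "\<dots> = (2 * 8) * Ainf_const v * A1_const u * ?X * ennreal \<theta>" by (simp only: ac_simps)
  finally show ?thesis unfolding \<Gamma>_def E_def by simp
qed

text \<open>Chebyshev's inequality: the average of \<open>v\<close> over \<open>I\<close> is at most
  2^\<open>avg_level v I\<close>.\<close>

lemma high_level_set:
  assumes v: "weight v" and I: "(I :: (real ^ 'n) set) \<in> grid \<alpha>"
    and E: "E \<in> sets lebesgue" "E \<subseteq> I" "\<And>x. x \<in> E \<Longrightarrow> 2 powi (avg_level v I + int n) < v x"
  shows "emeasure lebesgue E \<le> ennreal ((1 / 2) ^ n) * emeasure lebesgue I"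
proof -
  let ?k = "ennreal (2 powi (avg_level v I))"
  have k: "?k \<noteq> 0" "?k \<noteq> top" by (simp_all add: ennreal_eq_0_iff not_le)
  have half: "ennreal ((1 / 2) ^ n) * ennreal (2 powi int n) = 1"
    by (simp flip: ennreal_mult power_mult_distrib)
  have "?k * (ennreal (2 powi int n) * emeasure lebesgue E) = (\<integral>\<^sup>+x. ennreal (2 powi (avg_level v I + int n)) * indicator E x \<partial>lebesgue)"
    unfolding nn_integral_cmult_indicator[OF E(1)] ennreal_powi_add by (simp only: ac_simps)
  also have "\<dots> \<le> (\<integral>\<^sup>+x. ennreal (v x) * indicator I x \<partial>lebesgue)"
    using E(2) by (intro nn_integral_mono) (auto simp: indicator_def intro!: ennreal_leI less_imp_le[OF E(3)])
  also have "\<dots> = emeasure (wmeas v) I" using emeasure_wmeas[OF v sets_grid[OF I]] by simp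
  also have "\<dots> \<le> ?k * emeasure lebesgue I" by (rule avg_level_measure(2)[OF v I])
  finally have "ennreal (2 powi int n) * emeasure lebesgue E \<le> emeasure lebesgue I"
    using k by (subst (asm) ennreal_mult_le_mult_iff) auto
  then have "ennreal ((1 / 2) ^ n) * (ennreal (2 powi int n) * emeasure lebesgue E) \<le> ennreal ((1 / 2) ^ n) * emeasure lebesgue I"
    by (rule mult_left_mono) simp
  then show ?thesis unfolding mult.assoc[symmetric] half by simp
qed

text \<open>In \<open>Ap_small_set\<close> the ratio B t / a equals 4B / 2^l <= 2^(-(l - L)). As
  this is at most 1, the exponent 1/(p-1) may be lowered to 1/P. For l <= L the claim is trivial,
  truncated subtraction making the factor 1.\<close>

lemma low_level_set:
  assumes p: "1 < p" and v: "weight v" "Ap_const p v < top" and I: "(I :: (real ^ 'n) set) \<in> grid \<alpha>"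
    and P: "p - 1 \<le> real P" "0 < P" and L: "4 * enn2real (Ap_const p v) \<le> 2 ^ L"
    and E: "E \<in> sets lebesgue" "E \<subseteq> I" "\<And>x. x \<in> E \<Longrightarrow> 0 < v x \<and> v x \<le> 2 powi (avg_level v I - int l + 1)"
  shows "emeasure lebesgue E \<le> ennreal ((1 / 2) ^ ((l - L) div P)) * emeasure lebesgue I"
proof (cases "l \<le> L")
  case True
  then show ?thesis using emeasure_mono[OF E(2) sets_grid[OF I]] by simp
next
  case False
  define B where "B = enn2real (Ap_const p v)"
  define d where "d = l - L"
  have d: "l = L + d" using False by (simp add: d_def)
  have powi2: "(2::real) powi j = 2 powr of_int j" for j by (rule powr_real_of_int'[symmetric]) simp_all
  have ratio: "B * 2 powi (avg_level v I - int l + 1) / 2 powi (avg_level v I - 1) \<le> (1 / 2) ^ d"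
  proof -
    have eq: "2 powi (avg_level v I - int l + 1) / 2 powi (avg_level v I - 1) = (4::real) / 2 ^ l"
      unfolding powi2 by (simp add: powr_diff powr_add powr_realpow field_simps)
    have "B * 2 powi (avg_level v I - int l + 1) / 2 powi (avg_level v I - 1) = 4 * B / 2 ^ l"
      unfolding times_divide_eq_right[symmetric] eq by simp
    also have "\<dots> \<le> 2 ^ L / 2 ^ l" using L by (intro divide_right_mono) (auto simp: B_def)
    also have "\<dots> = (1 / 2) ^ d" unfolding d by (simp add: power_add power_one_over)
    finally show ?thesis .
  qed
  have "emeasure lebesgue E \<le> ennreal ((B * 2 powi (avg_level v I - int l + 1) / 2 powi (avg_level v I - 1)) powr (1 / (p - 1))) * emeasure lebesgue I"
    unfolding B_def
    by (rule Ap_small_set[OF p v I _ _ E]) (auto intro: less_imp_le avg_level(1)[OF v(1) I])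
  also have "\<dots> \<le> ennreal ((1 / 2) ^ (d div P)) * emeasure lebesgue I"
  proof (intro mult_right_mono ennreal_leI)
    have "(B * 2 powi (avg_level v I - int l + 1) / 2 powi (avg_level v I - 1)) powr (1 / (p - 1)) \<le> ((1 / 2) ^ d) powr (1 / (p - 1))"
      using ratio p by (intro powr_mono2) (auto simp: B_def)
    also have "\<dots> \<le> ((1 / 2) ^ d) powr (1 / real P)"
      using p P by (intro powr_mono') (auto simp: power_le_one frac_le)
    also have "\<dots> = (1 / 2) powr (real d / real P)"
      by (simp add: powr_powr flip: powr_realpow)
    also have "\<dots> \<le> (1 / 2) powr (real (d div P))"
      by (intro powr_mono') (auto simp: of_nat_div_le_of_nat)
    also have "\<dots> = (1 / 2) ^ (d div P)" by (simp add: powr_realpow)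
    finally show "(B * 2 powi (avg_level v I - int l + 1) / 2 powi (avg_level v I - 1)) powr (1 / (p - 1)) \<le> (1 / 2) ^ (d div P)" .
  qed simp
  finally show ?thesis unfolding d_def .
qed

section \<open>The grid estimates\<close>

lemma finite_grid_bound:
  fixes g :: "real ^ 'n \<Rightarrow> ennreal"
  assumes p: "1 < p" and v: "weight v" "Ap_const p v < top" and u: "weight u" "A1_const u < top"
    and N: "4 * 3 ^ CARD('n) * Ainf_const u \<le> of_nat N" "0 < N"
    and P: "p - 1 \<le> real P" "0 < P" and L: "4 * enn2real (Ap_const p v) \<le> 2 ^ L"
    and \<F>: "finite \<F>" "\<F> \<subseteq> grid \<alpha>" and g: "g \<in> borel_measurable lebesgue"
  shows "emeasure (uv_measure u v) {x. 0 < v x \<and> ennreal (v x) < grid_max \<F> g x}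
    \<le> 16 * Ainf_const v * A1_const u * (\<integral>\<^sup>+x. g x * ennreal (u x) \<partial>lebesgue) * of_nat (2 * L + 8 * P * N + 8 * N)"
proof -
  let ?K = "16 * Ainf_const v * A1_const u * (\<integral>\<^sup>+x. g x * ennreal (u x) \<partial>lebesgue)"
  let ?\<mu> = "uv_measure u v"
  have um[measurable]: "u \<in> borel_measurable lebesgue" and vm[measurable]: "v \<in> borel_measurable lebesgue"
    using u v by (auto simp: weight_def)
  define E where "E = (\<lambda>m I. {x \<in> I. 2 powi (avg_level v I + m) < v x \<and> v x \<le> 2 powi (avg_level v I + m + 1)})"
  define S where "S = (\<lambda>m. \<Union>I\<in>{I \<in> \<F>. I \<in> stop_cubes \<F> g (ennreal (2 powi (avg_level v I + m)))}. E m I)"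
  have Es: "E m I \<in> sets lebesgue" if I: "I \<in> \<F>" for m I
  proof -
    have Is: "I \<in> sets lebesgue" using I \<F>(2) sets_grid[of I \<alpha>] by blast
    have "E m I = I \<inter> {x \<in> space lebesgue. 2 powi (avg_level v I + m) < v x \<and> v x \<le> 2 powi (avg_level v I + m + 1)}"
      by (auto simp: E_def)
    also have "\<dots> \<in> sets lebesgue" using Is by (rule sets.Int) measurable
    finally show ?thesis .
  qed
  have Ss: "S m \<in> sets ?\<mu>" for m
    unfolding S_def uv_measure_def sets_density using \<F>(1) Es by (intro sets.finite_UN) auto
  have EI: "E m I \<subseteq> I" for m I by (auto simp: E_def)
  have S_bound: "emeasure ?\<mu> (S m) \<le> ?K * ennreal \<theta>"
    if "\<And>I. I \<in> \<F> \<Longrightarrow> emeasure (wmeas u) (E m I) \<le> ennreal \<theta> * emeasure (wmeas u) I" for m \<theta>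
    unfolding S_def E_def by (rule level_measure[OF v(1) u \<F> g]) (use that in \<open>simp add: E_def\<close>)
  have pos: "emeasure ?\<mu> (S (int n)) \<le> ?K * ennreal (2 * (1 / 2) ^ (n div (2 * N)))" for n
  proof (rule S_bound)
    fix I assume I: "I \<in> \<F>"
    then have Ig: "I \<in> grid \<alpha>" using \<F> by auto
    have "emeasure lebesgue (E (int n) I) \<le> ennreal ((1 / 2) ^ n) * emeasure lebesgue I"
      by (rule high_level_set[OF v(1) Ig Es[OF I] EI]) (simp add: E_def)
    then show "emeasure (wmeas u) (E (int n) I) \<le> ennreal (2 * (1 / 2) ^ (n div (2 * N))) * emeasure (wmeas u) I"
      by (rule wmeas_small_set_dyadic[OF u(1) N Ig Es[OF I] EI])
  qed
  have neg: "emeasure ?\<mu> (S (- int l)) \<le> ?K * ennreal (2 * (1 / 2) ^ ((l - L) div (P * (2 * N))))" for l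
  proof (rule S_bound)
    fix I assume I: "I \<in> \<F>"
    then have Ig: "I \<in> grid \<alpha>" using \<F> by auto
    have "emeasure lebesgue (E (- int l) I) \<le> ennreal ((1 / 2) ^ ((l - L) div P)) * emeasure lebesgue I"
    proof (rule low_level_set[OF p v Ig P L Es[OF I] EI])
      fix x assume x: "x \<in> E (- int l) I"
      have "(0::real) < 2 powi (avg_level v I + - int l)" by simp
      also have "\<dots> < v x" using x by (simp add: E_def)
      finally show "0 < v x \<and> v x \<le> 2 powi (avg_level v I - int l + 1)" using x by (simp add: E_def)
    qed
    from wmeas_small_set_dyadic[OF u(1) N Ig Es[OF I] EI this]
    show "emeasure (wmeas u) (E (- int l) I) \<le> ennreal (2 * (1 / 2) ^ ((l - L) div (P * (2 * N)))) * emeasure (wmeas u) I"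
      \<comment> \<open>The two divisions, by \<open>P\<close> from the A_p decay and by
        \<open>2 * N\<close> from the decay of \<open>u\<close>, merge into one.\<close>
      by (simp only: div_mult2_eq)
  qed
  \<comment> \<open>With 2^k < v(x) <= 2^(k+1), a cell through x whose average beats v(x) also beats
    2^k, and a maximal such cell \<open>I\<close> contains it. So x lies in the slice with m = k -
    \<open>avg_level v I\<close>. The value m = 0 belongs to both unions, which is harmless for an
    upper bound.\<close>
  have cover: "{x. 0 < v x \<and> ennreal (v x) < grid_max \<F> g x} \<subseteq> (\<Union>n. S (int n)) \<union> (\<Union>l. S (- int l))"
  proof
    fix x assume "x \<in> {x. 0 < v x \<and> ennreal (v x) < grid_max \<F> g x}"
    then have x: "0 < v x" "ennreal (v x) < grid_max \<F> g x" by auto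
    define k where "k = \<lceil>log 2 (v x)\<rceil> - 1"
    have k: "of_int k < log 2 (v x)" "log 2 (v x) \<le> of_int (k + 1)"
      unfolding k_def using ceiling_correct[of "log 2 (v x)"] by simp_all
    have "(2::real) powi j = 2 powr of_int j" for j by (rule powr_real_of_int'[symmetric]) simp_all
    moreover have "2 powr log 2 (v x) = v x" using x by simp
    ultimately have kv: "2 powi k < v x" "v x \<le> 2 powi (k + 1)"
      using powr_less_mono[OF k(1), of 2] powr_mono[OF k(2), of 2] by simp_all
    obtain R where R: "R \<in> \<F>" "x \<in> R" "ennreal (v x) < average R g"
      using x(2) unfolding grid_max_def by (auto simp: less_SUP_iff)
    have "ennreal (2 powi k) \<le> ennreal (v x)" using kv by (intro ennreal_leI) simp
    then have "ennreal (2 powi k) < average R g" using R(3) by (rule le_less_trans)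
    then have "\<exists>I\<in>tops {I \<in> \<F>. ennreal (2 powi k) < average I g}. R \<subseteq> I"
      using \<F>(1) R(1) by (intro tops_exists) auto
    then obtain I where I: "I \<in> stop_cubes \<F> g (ennreal (2 powi k))" "R \<subseteq> I"
      unfolding stop_cubes_def by blast
    have I\<F>: "I \<in> \<F>" using I(1) tops_subset unfolding stop_cubes_def by blast
    define m where "m = k - avg_level v I"
    have km: "k = avg_level v I + m" by (simp add: m_def)
    have "x \<in> E m I" using I(2) R(2) kv unfolding km E_def by auto
    then have "x \<in> S m" unfolding S_def using I\<F> I(1) unfolding km by auto
    moreover have "m = int (nat m) \<or> m = - int (nat (- m))" by auto
    ultimately show "x \<in> (\<Union>n. S (int n)) \<union> (\<Union>l. S (- int l))" by (metis UnI1 UnI2 UN_I UNIV_I)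
  qed
  have sum_pos: "emeasure ?\<mu> (\<Union>n. S (int n)) \<le> ?K * of_nat (8 * N)"
  proof -
    have "emeasure ?\<mu> (\<Union>n. S (int n)) \<le> (\<Sum>n. emeasure ?\<mu> (S (int n)))"
      using Ss by (intro emeasure_subadditive_countably) auto
    also have "\<dots> \<le> (\<Sum>n. (?K * 2) * ennreal ((1 / 2) ^ (n div (2 * N))))"
    proof (intro suminf_le summableI)
      fix n show "emeasure ?\<mu> (S (int n)) \<le> (?K * 2) * ennreal ((1 / 2) ^ (n div (2 * N)))"
        using pos[of n] by (simp add: ennreal_mult mult.assoc)
    qed
    also have "\<dots> = (?K * 2) * (\<Sum>n. ennreal ((1 / 2) ^ (n div (2 * N))))" by (rule ennreal_suminf_cmult)
    also have "\<dots> \<le> (?K * 2) * (2 * of_nat (2 * N))"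
      using N(2) by (intro mult_left_mono suminf_half_div) auto
    also have "\<dots> = ?K * of_nat (8 * N)" by (simp add: mult.assoc)
    finally show ?thesis .
  qed
  have sum_neg: "emeasure ?\<mu> (\<Union>l. S (- int l)) \<le> ?K * of_nat (2 * L + 8 * P * N)"
  proof -
    have "emeasure ?\<mu> (\<Union>l. S (- int l)) \<le> (\<Sum>l. emeasure ?\<mu> (S (- int l)))"
      using Ss by (intro emeasure_subadditive_countably) auto
    also have "\<dots> \<le> (\<Sum>l. (?K * 2) * ennreal ((1 / 2) ^ ((l - L) div (P * (2 * N)))))"
    proof (intro suminf_le summableI)
      fix l show "emeasure ?\<mu> (S (- int l)) \<le> (?K * 2) * ennreal ((1 / 2) ^ ((l - L) div (P * (2 * N))))"
        using neg[of l] by (simp add: ennreal_mult mult.assoc)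
    qed
    also have "\<dots> = (?K * 2) * (\<Sum>l. ennreal ((1 / 2) ^ ((l - L) div (P * (2 * N)))))" by (rule ennreal_suminf_cmult)
    also have "\<dots> \<le> (?K * 2) * (of_nat L + 2 * of_nat (P * (2 * N)))"
      using N(2) P(2) by (intro mult_left_mono suminf_half_div_shift) auto
    also have "\<dots> = ?K * (2 * (of_nat L + 2 * of_nat (P * (2 * N))))" by (simp only: mult.assoc)
    also have "2 * (of_nat L + 2 * of_nat (P * (2 * N))) = (of_nat (2 * (L + 2 * (P * (2 * N)))) :: ennreal)"
      by (simp only: of_nat_add of_nat_mult of_nat_numeral)
    also have "2 * (L + 2 * (P * (2 * N))) = 2 * L + 8 * P * N" by simp
    finally show ?thesis .
  qed
  have "emeasure ?\<mu> {x. 0 < v x \<and> ennreal (v x) < grid_max \<F> g x} \<le> emeasure ?\<mu> ((\<Union>n. S (int n)) \<union> (\<Union>l. S (- int l)))"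
    using Ss by (intro emeasure_mono cover sets.Un sets.countable_UN) auto
  also have "\<dots> \<le> emeasure ?\<mu> (\<Union>n. S (int n)) + emeasure ?\<mu> (\<Union>l. S (- int l))"
    using Ss by (intro emeasure_subadditive sets.countable_UN) auto
  also have "\<dots> \<le> ?K * of_nat (8 * N) + ?K * of_nat (2 * L + 8 * P * N)"
    by (rule add_mono[OF sum_pos sum_neg])
  also have "\<dots> = ?K * of_nat (2 * L + 8 * P * N + 8 * N)"
    unfolding distrib_left[symmetric] of_nat_add[symmetric] by (simp only: ac_simps)
  finally show ?thesis .
qed

text \<open>The grid is countable, so its initial segments give increasing sets with union
  \<open>S\<close>; the bound for finite families is uniform and passes to the limit.\<close>

lemma grid_bound:
  fixes g :: "real ^ 'n \<Rightarrow> ennreal" and \<alpha> :: "'n \<Rightarrow> bool"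
  assumes p: "1 < p" and v: "weight v" "Ap_const p v < top" and u: "weight u" "A1_const u < top"
    and N: "4 * 3 ^ CARD('n) * Ainf_const u \<le> of_nat N" "0 < N"
    and P: "p - 1 \<le> real P" "0 < P" and L: "4 * enn2real (Ap_const p v) \<le> 2 ^ L"
    and g: "g \<in> borel_measurable lebesgue"
  defines "S \<equiv> {x. 0 < v x \<and> ennreal (v x) < grid_max (grid \<alpha>) g x}"
  shows "S \<in> sets lebesgue"
    "emeasure (uv_measure u v) S
    \<le> 16 * Ainf_const v * A1_const u * (\<integral>\<^sup>+x. g x * ennreal (u x) \<partial>lebesgue) * of_nat (2 * L + 8 * P * N + 8 * N)"
proof -
  have um[measurable]: "u \<in> borel_measurable lebesgue" and vm[measurable]: "v \<in> borel_measurable lebesgue"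
    using u v by (auto simp: weight_def)
  have ne: "grid \<alpha> \<noteq> ({} :: (real ^ 'n) set set)" using cell_at_grid by blast
  define F where "F = (\<lambda>M. from_nat_into (grid \<alpha> :: (real ^ 'n) set set) ` {..<M})"
  have F: "finite (F M)" "F M \<subseteq> grid \<alpha>" for M using from_nat_into[OF ne] by (auto simp: F_def)
  define T where "T = (\<lambda>M::nat. {x. 0 < v x \<and> ennreal (v x) < grid_max (F M) g x})"
  have Ts: "T M \<in> sets lebesgue" for M
  proof -
    have [measurable]: "grid_max (F M) g \<in> borel_measurable lebesgue" by (rule measurable_grid_max[OF F])
    have "T M = {x \<in> space lebesgue. 0 < v x \<and> ennreal (v x) < grid_max (F M) g x}" by (simp add: T_def)
    also have "\<dots> \<in> sets lebesgue" by measurable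
    finally show ?thesis .
  qed
  have ST: "S = (\<Union>M. T M)"
  proof
    show "S \<subseteq> (\<Union>M. T M)"
    proof
      fix x assume "x \<in> S"
      then obtain R where R: "0 < v x" "R \<in> grid \<alpha>" "x \<in> R" "ennreal (v x) < average R g"
        unfolding S_def grid_max_def by (auto simp: less_SUP_iff)
      obtain j where "R = from_nat_into (grid \<alpha>) j"
        using from_nat_into_surj[OF countable_grid R(2)] by metis
      then have "R \<in> F (Suc j)" by (auto simp: F_def)
      then have "average R g \<le> grid_max (F (Suc j)) g x" using R(3) by (intro grid_max_upper)
      then have "x \<in> T (Suc j)" using R by (auto simp: T_def)
      then show "x \<in> (\<Union>M. T M)" by blast
    qed
    have "grid_max (F M) g x \<le> grid_max (grid \<alpha>) g x" for M x
      unfolding grid_max_def using F(2)[of M] by (intro SUP_subset_mono) auto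
    then show "(\<Union>M. T M) \<subseteq> S" unfolding S_def T_def by (auto intro: less_le_trans)
  qed
  show "S \<in> sets lebesgue" unfolding ST using Ts by auto
  have inc: "incseq T"
  proof (rule incseq_SucI)
    fix M
    have "grid_max (F M) g x \<le> grid_max (F (Suc M)) g x" for x
      unfolding grid_max_def by (intro SUP_subset_mono) (auto simp: F_def)
    then show "T M \<subseteq> T (Suc M)" unfolding T_def by (auto intro: less_le_trans)
  qed
  have "emeasure (uv_measure u v) S = (SUP M. emeasure (uv_measure u v) (T M))"
    unfolding ST using Ts inc by (intro SUP_emeasure_incseq[symmetric]) (auto simp: uv_measure_def)
  also have "\<dots> \<le> 16 * Ainf_const v * A1_const u * (\<integral>\<^sup>+x. g x * ennreal (u x) \<partial>lebesgue) * of_nat (2 * L + 8 * P * N + 8 * N)"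
    unfolding T_def by (intro SUP_least finite_grid_bound[OF p v u N P L F g])
  finally show "emeasure (uv_measure u v) S
    \<le> 16 * Ainf_const v * A1_const u * (\<integral>\<^sup>+x. g x * ennreal (u x) \<partial>lebesgue) * of_nat (2 * L + 8 * P * N + 8 * N)" .
qed

section \<open>Passing from cubes to grids\<close>

lemma average_cube_le_grid:
  assumes "(C :: (real ^ 'n) set) \<in> cubes"
  shows "\<exists>\<alpha>. \<exists>R\<in>grid \<alpha>. C \<subseteq> R \<and> average C h \<le> 6 ^ CARD('n) * average R h"
proof -
  obtain \<alpha> R where R: "R \<in> grid \<alpha>" "C \<subseteq> R" "emeasure lebesgue R \<le> 6 ^ CARD('n) * emeasure lebesgue C"
    using cube_in_grid_cell[OF assms] .
  obtain a l where "C = cbox a (a + (\<chi> i. l))" "0 < l" using assms by (auto simp: cubes_def)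
  then have "emeasure lebesgue C = ennreal (l ^ CARD('n))" "0 < l" using emeasure_cube[of l a] by simp_all
  then have C0: "0 < emeasure lebesgue C" by simp
  have "(\<integral>\<^sup>+x\<in>C. h x \<partial>lebesgue) \<le> (\<integral>\<^sup>+x\<in>R. h x \<partial>lebesgue)"
    using R(2) by (intro nn_integral_mono) (auto simp: indicator_def)
  also have "\<dots> = average R h * emeasure lebesgue R" using average_mult[OF R(1)] by simp
  also have "\<dots> \<le> average R h * (6 ^ CARD('n) * emeasure lebesgue C)" by (rule mult_left_mono[OF R(3)]) simp
  also have "\<dots> = emeasure lebesgue C * (6 ^ CARD('n) * average R h)" by (simp only: ac_simps)
  finally have "average C h \<le> 6 ^ CARD('n) * average R h"
    unfolding average_def[of C] by (rule divide_le_posI_ennreal[OF C0])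
  then show ?thesis using R by blast
qed

text \<open>The grid may depend on x. The strict inequality is what lets one cube, and hence one
  cell, be extracted from the supremum.\<close>

lemma maximal_less_grid_max:
  assumes "s < maximal f (x :: real ^ 'n)"
  shows "\<exists>\<alpha>. s < 6 ^ CARD('n) * grid_max (grid \<alpha>) (\<lambda>y. ennreal \<bar>f y\<bar>) x"
proof -
  let ?h = "\<lambda>y. ennreal \<bar>f y\<bar>"
  obtain C where C: "C \<in> cubes" "x \<in> C" "s < average C ?h"
    using assms unfolding maximal_def by (auto simp: less_SUP_iff)
  obtain \<alpha> R where R: "R \<in> grid \<alpha>" "C \<subseteq> R" "average C ?h \<le> 6 ^ CARD('n) * average R ?h"
    using average_cube_le_grid[OF C(1), of ?h] by blast
  note C(3)
  also note R(3)
  also have "6 ^ CARD('n) * average R ?h \<le> 6 ^ CARD('n) * grid_max (grid \<alpha>) ?h x"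
    using R C(2) by (intro mult_left_mono grid_max_upper) auto
  finally show ?thesis by (rule exI[of _ \<alpha>])
qed

lemma grid_max_cmult:
  assumes "h \<in> borel_measurable lebesgue"
  shows "grid_max (grid \<alpha>) (\<lambda>y. c * h y) x = c * grid_max (grid \<alpha>) h (x :: real ^ 'n)"
proof -
  have "average R (\<lambda>y. c * h y) = c * average R h" if "R \<in> grid \<alpha>" for R
  proof -
    have "(\<integral>\<^sup>+y\<in>R. c * h y \<partial>lebesgue) = c * (\<integral>\<^sup>+y\<in>R. h y \<partial>lebesgue)"
      unfolding mult.assoc using assms sets_grid[OF that]
      by (intro nn_integral_cmult borel_measurable_times_ennreal borel_measurable_indicator)
    then show ?thesis by (simp add: average_def ennreal_times_divide)
  qed
  moreover have "{R \<in> grid \<alpha>. x \<in> R} \<noteq> {}"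
    using cell_at_self cell_at_grid by blast
  ultimately show ?thesis unfolding grid_max_def by (simp add: SUP_mult_left_ennreal)
qed

text \<open>Rounds the real quantities to naturals: \<open>N\<close> for 4 * 3^n w, \<open>P\<close>
  for p - 1 and \<open>L\<close> for log_2 of 4(B + 1). The \<open>+ 1\<close> keeps the logarithm
  meaningful at B = 0.\<close>

lemma parameters_exist:
  fixes p w B :: real
  assumes "1 < p" "1 \<le> w" "0 \<le> B"
  obtains N P L :: nat where "4 * 3 ^ n * w \<le> real N" "0 < N" "p - 1 \<le> real P" "0 < P" "4 * B \<le> 2 ^ L"
    "real (2 * L + 8 * P * N + 8 * N) \<le> 110 * 3 ^ n * w * max p (1 + ln (B + 1))"
proof -
  define M where "M = max p (1 + ln (B + 1))"
  define N where "N = nat \<lceil>4 * 3 ^ n * w\<rceil>"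
  define P where "P = nat \<lceil>p - 1\<rceil>"
  define L where "L = nat \<lceil>log 2 (4 * (B + 1))\<rceil>"
  have w3: "1 \<le> 3 ^ n * w" using mult_mono[of 1 "3 ^ n" 1 w] assms(2) by simp
  \<comment> \<open>Rounding up adds at most 1 <= 3^n w, which turns the factor 4 into 5.\<close>
  have N: "4 * 3 ^ n * w \<le> real N" "real N \<le> 5 * (3 ^ n * w)" "1 \<le> real N"
    unfolding N_def using w3 by linarith+
  have P: "p - 1 \<le> real P" "real P \<le> p" "0 < P"
    unfolding P_def using assms(1) by linarith+
  have log: "log 2 (4 * (B + 1)) = 2 + log 2 (B + 1)"
  proof -
    have "log 2 (4::real) = 2" using log_pow_cancel[of 2 2] by simp
    moreover have "log 2 (4 * (B + 1)) = log 2 4 + log 2 (B + 1)"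
      using assms(3) by (intro log_mult_pos) auto
    ultimately show ?thesis by (simp only:)
  qed
  \<comment> \<open>Change to the natural logarithm of the statement; 1 / ln 2 <= 2.\<close>
  have "log 2 (B + 1) \<le> 2 * ln (B + 1)"
  proof -
    have l: "1 / 2 \<le> ln (2::real)" using ln2_ge_two_thirds by simp
    have "1 * ln (B + 1) \<le> (2 * ln 2) * ln (B + 1)" using l assms(3) by (intro mult_right_mono) auto
    then show ?thesis using l by (simp add: log_def field_simps)
  qed
  moreover have "0 \<le> log 2 (B + 1)" using assms(3) by simp
  ultimately have L: "log 2 (4 * (B + 1)) \<le> real L" "real L \<le> 3 + 2 * ln (B + 1)"
    unfolding L_def log by linarith+
  have "4 * B \<le> 2 powr log 2 (4 * (B + 1))" using assms(3) by simp
  also have "\<dots> \<le> 2 powr real L" using L(1) by (intro powr_mono) auto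
  finally have L2: "4 * B \<le> 2 ^ L" by (simp add: powr_realpow)
  have "0 \<le> ln (B + 1)" using assms(3) by (intro ln_ge_zero) simp
  moreover have "3 + 2 * y \<le> 3 * (1 + y)" if "0 \<le> y" for y :: real using that by simp
  ultimately have "real L \<le> 3 * (1 + ln (B + 1))" using L(2) by (metis order_trans)
  also have "\<dots> \<le> 3 * M" unfolding M_def by (intro mult_left_mono) auto
  finally have LM: "real L \<le> 3 * M" .
  have M: "1 \<le> M" "real P \<le> M" unfolding M_def using P(2) assms(1) by auto
  have MN: "M \<le> M * real N" "real N \<le> M * real N" "real P * real N \<le> M * real N"
    using mult_left_mono[OF N(3), of M] mult_right_mono[OF M(1), of "real N"] mult_right_mono[OF M(2), of "real N"] M
    by simp_all
  have "real (2 * L + 8 * P * N + 8 * N) = 2 * real L + 8 * (real P * real N) + 8 * real N" by simp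
  \<comment> \<open>Here 22 = 6 + 8 + 8, as 2L <= 6M and M, N and PN are all at most MN. The final
    110 is 22 * 5.\<close>
  also have "\<dots> \<le> 22 * (M * real N)" using LM MN by linarith
  also have "\<dots> \<le> 22 * (M * (5 * (3 ^ n * w)))" using N(2) M by (intro mult_left_mono) auto
  finally have "real (2 * L + 8 * P * N + 8 * N) \<le> 110 * 3 ^ n * w * M" by (simp add: ac_simps)
  then show ?thesis using that[of N P L] N P L2 unfolding M_def by simp
qed

section \<open>The mixed weak-type inequality\<close>

lemma mixed_weak_type_level:
  fixes u v f :: "real ^ 'n \<Rightarrow> real"
  assumes p: "1 < p" and v: "weight v" "Ap_const p v < top" and u: "weight u" "A1_const u < top"
    and f: "f \<in> borel_measurable lebesgue" and t: "0 < t"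
  shows "ennreal t * emeasure (uv_measure u v) {x. ennreal t < maximal (\<lambda>y. f y * v y) x / ennreal (v x)}
    \<le> ennreal (1760 * 36 ^ CARD('n)) * A1_const u * Ainf_const v *
      (Ainf_const u * ennreal (max p (1 + ln (enn2real (Ap_const p v) + 1)))) * L1_norm (uv_measure u v) f"
proof -
  let ?\<mu> = "uv_measure u v"
  let ?d = "CARD('n)"
  let ?M = "max p (1 + ln (enn2real (Ap_const p v) + 1))"
  have um[measurable]: "u \<in> borel_measurable lebesgue" and u0: "\<And>x. 0 \<le> u x"
    and vm[measurable]: "v \<in> borel_measurable lebesgue" and v0: "\<And>x. 0 \<le> v x"
    using u v by (auto simp: weight_def)
  note fm[measurable] = f
  define w where "w = enn2real (Ainf_const u)"
  \<comment> \<open>Finiteness comes from the A_1 condition, so the constant can be represented by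
    the real \<open>w\<close>.\<close>
  have "Ainf_const u < top" using Ainf_le_A1[OF u] u(2) by (rule le_less_trans)
  then have w: "Ainf_const u = ennreal w" "1 \<le> w"
    using Ainf_ge_1[OF u(1)] by (auto simp: w_def) (metis ennreal_1 ennreal_enn2real ennreal_le_iff enn2real_nonneg)
  obtain N P L :: nat where N: "4 * 3 ^ ?d * w \<le> real N" "0 < N" and P: "p - 1 \<le> real P" "0 < P"
    and L: "4 * enn2real (Ap_const p v) \<le> 2 ^ L"
    and NPL: "real (2 * L + 8 * P * N + 8 * N) \<le> 110 * 3 ^ ?d * w * ?M"
    using parameters_exist[OF p w(2) enn2real_nonneg] by blast
  have N': "4 * 3 ^ ?d * Ainf_const u \<le> of_nat N"
  proof -
    have "4 * 3 ^ ?d * Ainf_const u = ennreal (4 * 3 ^ ?d * w)"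
      using w by (simp add: ennreal_mult ennreal_numeral_power)
    also have "\<dots> \<le> ennreal (real N)" by (rule ennreal_leI[OF N(1)])
    finally show ?thesis by (simp add: ennreal_of_nat_eq_real_of_nat)
  qed
  define h where "h = (\<lambda>y. ennreal \<bar>f y * v y\<bar>)"
  \<comment> \<open>\<open>c\<close> absorbs the height t and the loss 6^n between cubes and cells,
    so that the grid estimate only has to compare with \<open>v\<close> itself.\<close>
  define c where "c = ennreal (6 ^ ?d / t)"
  have tc: "ennreal t * c = 6 ^ ?d"
    using t unfolding c_def ennreal_numeral_power[symmetric] by (simp flip: ennreal_mult)
  have h[measurable]: "h \<in> borel_measurable lebesgue" unfolding h_def by measurable
  have ch: "(\<lambda>y. c * h y) \<in> borel_measurable lebesgue" by measurable
  define S where "S = (\<lambda>\<alpha>. {x. 0 < v x \<and> ennreal (v x) < grid_max (grid \<alpha>) (\<lambda>y. c * h y) x})"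
  let ?X = "\<integral>\<^sup>+x. c * h x * ennreal (u x) \<partial>lebesgue"
  let ?K = "16 * Ainf_const v * A1_const u * ?X * of_nat (2 * L + 8 * P * N + 8 * N)"
  have S: "S \<alpha> \<in> sets lebesgue" "emeasure ?\<mu> (S \<alpha>) \<le> ?K" for \<alpha>
    unfolding S_def by (rule grid_bound[OF p v u N' N(2) P L ch])+
  \<comment> \<open>Where \<open>v\<close> vanishes the quotient may be \<open>top\<close>, so these
    points are split off; the density u v is 0 there.\<close>
  define Z where "Z = {x \<in> space lebesgue. v x = 0}"
  have Zs: "Z \<in> sets lebesgue" unfolding Z_def by measurable
  have Z: "emeasure ?\<mu> Z = 0"
  proof -
    have "emeasure ?\<mu> Z = (\<integral>\<^sup>+x. ennreal (u x * v x) * indicator Z x \<partial>lebesgue)"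
      unfolding uv_measure_def using Zs by (intro emeasure_density) auto
    also have "\<dots> = (\<integral>\<^sup>+x. 0 \<partial>(lebesgue :: (real ^ 'n) measure))"
      by (intro nn_integral_cong) (auto simp: Z_def indicator_def)
    finally show ?thesis by simp
  qed
  have "{x. ennreal t < maximal (\<lambda>y. f y * v y) x / ennreal (v x)} \<subseteq> Z \<union> (\<Union>\<alpha>\<in>UNIV. S \<alpha>)"
  proof
    fix x assume "x \<in> {x. ennreal t < maximal (\<lambda>y. f y * v y) x / ennreal (v x)}"
    then have x: "ennreal t < maximal (\<lambda>y. f y * v y) x / ennreal (v x)" by simp
    show "x \<in> Z \<union> (\<Union>\<alpha>\<in>UNIV. S \<alpha>)"
    proof (cases "v x = 0")
      case False
      then have vx: "0 < v x" using v0[of x] by simp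
      have "ennreal (v x) * ennreal t < maximal (\<lambda>y. f y * v y) x"
      proof (rule ccontr)
        assume "\<not> ?thesis"
        then have "maximal (\<lambda>y. f y * v y) x \<le> ennreal (v x) * ennreal t" by simp
        then have "maximal (\<lambda>y. f y * v y) x / ennreal (v x) \<le> ennreal t"
          using vx by (intro divide_le_posI_ennreal) auto
        then show False using x by simp
      qed
      then obtain \<alpha> where "ennreal (v x) * ennreal t < 6 ^ ?d * grid_max (grid \<alpha>) h x"
        using maximal_less_grid_max unfolding h_def by blast
      then have lt: "ennreal t * ennreal (v x) < ennreal t * (c * grid_max (grid \<alpha>) h x)"
        unfolding mult.assoc[symmetric] tc by (simp only: mult.commute)
      have "ennreal (v x) < c * grid_max (grid \<alpha>) h x"
      proof (rule ccontr)
        assume "\<not> ?thesis"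
        then have "ennreal t * (c * grid_max (grid \<alpha>) h x) \<le> ennreal t * ennreal (v x)"
          by (intro mult_left_mono) auto
        then show False using lt by simp
      qed
      then have "x \<in> S \<alpha>" using vx unfolding S_def grid_max_cmult[OF h] by simp
      then show ?thesis by blast
    qed (simp add: Z_def)
  qed
  then have "emeasure ?\<mu> {x. ennreal t < maximal (\<lambda>y. f y * v y) x / ennreal (v x)} \<le> emeasure ?\<mu> (Z \<union> (\<Union>\<alpha>\<in>UNIV. S \<alpha>))"
    using Zs S(1) by (intro emeasure_mono) (auto simp: uv_measure_def)
  also have "\<dots> \<le> emeasure ?\<mu> Z + emeasure ?\<mu> (\<Union>\<alpha>\<in>UNIV. S \<alpha>)"
    using Zs S(1) by (intro emeasure_subadditive) (auto simp: uv_measure_def)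
  also have "\<dots> = emeasure ?\<mu> (\<Union>\<alpha>\<in>UNIV. S \<alpha>)" unfolding Z by simp
  also have "\<dots> \<le> (\<Sum>\<alpha>\<in>UNIV. emeasure ?\<mu> (S \<alpha>))"
    using S(1) by (intro emeasure_subadditive_finite) (auto simp: uv_measure_def)
  also have "\<dots> \<le> (\<Sum>\<alpha>\<in>(UNIV :: ('n \<Rightarrow> bool) set). ?K)" by (rule sum_mono[OF S(2)])
  \<comment> \<open>One term for each of the 2^n shifts.\<close>
  also have "\<dots> = 2 ^ ?d * ?K" by (simp add: card_fun)
  finally have main: "emeasure ?\<mu> {x. ennreal t < maximal (\<lambda>y. f y * v y) x / ennreal (v x)} \<le> 2 ^ ?d * ?K" .
  \<comment> \<open>With g = c |f v| the integral of g u is c times the L^1(uv) norm of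
    \<open>f\<close>.\<close>
  have X: "?X = c * L1_norm ?\<mu> f"
  proof -
    have "L1_norm ?\<mu> f = (\<integral>\<^sup>+x. ennreal (u x * v x) * ennreal \<bar>f x\<bar> \<partial>lebesgue)"
      unfolding L1_norm_def uv_measure_def by (intro nn_integral_density) auto
    also have "\<dots> = (\<integral>\<^sup>+x. h x * ennreal (u x) \<partial>lebesgue)"
      unfolding h_def using u0 v0
      by (intro nn_integral_cong) (simp add: abs_mult ac_simps flip: ennreal_mult)
    finally have "c * L1_norm ?\<mu> f = (\<integral>\<^sup>+x. c * (h x * ennreal (u x)) \<partial>lebesgue)"
      by (simp add: nn_integral_cmult)
    then show ?thesis by (simp only: mult.assoc)
  qed
  have NPL': "of_nat (2 * L + 8 * P * N + 8 * N) \<le> ennreal (110 * 3 ^ ?d) * (Ainf_const u * ennreal ?M)"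
  proof -
    have "of_nat (2 * L + 8 * P * N + 8 * N) = ennreal (real (2 * L + 8 * P * N + 8 * N))"
      by (rule ennreal_of_nat_eq_real_of_nat)
    also have "\<dots> \<le> ennreal (110 * 3 ^ ?d * w * ?M)" by (rule ennreal_leI[OF NPL])
    also have "\<dots> = ennreal (110 * 3 ^ ?d) * (ennreal w * ennreal ?M)"
    proof -
      have "ennreal w * ennreal ?M = ennreal (w * ?M)" using w(2) p by (intro ennreal_mult[symmetric]) auto
      moreover have "ennreal (110 * 3 ^ ?d * (w * ?M)) = ennreal (110 * 3 ^ ?d) * ennreal (w * ?M)"
        using w(2) p by (intro ennreal_mult) auto
      ultimately show ?thesis by (simp only: mult.assoc)
    qed
    finally show ?thesis unfolding w(1) .
  qed
  have "ennreal t * emeasure ?\<mu> {x. ennreal t < maximal (\<lambda>y. f y * v y) x / ennreal (v x)} \<le> ennreal t * (2 ^ ?d * ?K)"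
    by (rule mult_left_mono[OF main]) simp
  also have "\<dots> = (2 ^ ?d * (ennreal t * c) * 16) * (A1_const u * Ainf_const v * L1_norm ?\<mu> f) * of_nat (2 * L + 8 * P * N + 8 * N)"
    unfolding X by (simp only: ac_simps)
  also have "\<dots> \<le> (2 ^ ?d * (ennreal t * c) * 16) * (A1_const u * Ainf_const v * L1_norm ?\<mu> f) * (ennreal (110 * 3 ^ ?d) * (Ainf_const u * ennreal ?M))"
    by (rule mult_left_mono[OF NPL']) simp
  also have "\<dots> = (2 ^ ?d * (ennreal t * c) * 16 * ennreal (110 * 3 ^ ?d)) * A1_const u * Ainf_const v * (Ainf_const u * ennreal ?M) * L1_norm ?\<mu> f"
    by (simp only: ac_simps)
  \<comment> \<open>Collects the constants: 1760 = 16 * 110, and 36 = 2 * 6 * 3 from the number of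
    grids, the loss between cubes and cells, and the parent cells.\<close>
  also have "2 ^ ?d * (ennreal t * c) * 16 * ennreal (110 * 3 ^ ?d) = ennreal (1760 * 36 ^ ?d)"
  proof -
    have "2 ^ ?d * 6 ^ ?d * 16 * (110 * 3 ^ ?d) = (16 * 110) * (2 ^ ?d * 6 ^ ?d * 3 ^ ?d :: real)"
      by (simp only: ac_simps)
    also have "\<dots> = (16 * 110) * (2 * 6 * 3) ^ ?d" by (simp only: power_mult_distrib)
    also have "\<dots> = 1760 * 36 ^ ?d" by simp
    finally have "2 ^ ?d * 6 ^ ?d * 16 * (110 * 3 ^ ?d) = (1760 * 36 ^ ?d :: real)" .
    then have "ennreal (1760 * 36 ^ ?d) = ennreal (2 ^ ?d * 6 ^ ?d * 16 * (110 * 3 ^ ?d))" by (simp only:)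
    also have "\<dots> = 2 ^ ?d * 6 ^ ?d * 16 * ennreal (110 * 3 ^ ?d)"
      by (simp only: ennreal_mult zero_le_power zero_le_numeral mult_nonneg_nonneg ennreal_numeral_power ennreal_numeral)
    finally show ?thesis unfolding tc ..
  qed
  finally show ?thesis .
qed

theorem theorem4p1:
  "\<exists>c::real. 0 < c \<and>
    (\<forall>(p::real) (u :: real ^ 'n \<Rightarrow> real) (v :: real ^ 'n \<Rightarrow> real) (f :: real ^ 'n \<Rightarrow> real).
      1 < p \<longrightarrow> v \<in> Ap_class p \<longrightarrow> u \<in> A1_class \<longrightarrow> integrable (uv_measure u v) f \<longrightarrow>
      weak_L1_norm (uv_measure u v) (\<lambda>x. maximal (\<lambda>y. f y * v y) x / ennreal (v x))
        \<le> ennreal c * A1_const u * Ainf_const v *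
          (A1_const u * Ainf_const v +
           Ainf_const u * ennreal (max p (1 + ln (enn2real (Ap_const p v) + 1)))) *
          L1_norm (uv_measure u v) f)"
proof (intro exI[of _ "1760 * 36 ^ CARD('n)"] conjI allI impI)
  fix p :: real and u v f :: "real ^ 'n \<Rightarrow> real"
  assume p: "1 < p" and v: "v \<in> Ap_class p" and u: "u \<in> A1_class" and f: "integrable (uv_measure u v) f"
  have v': "weight v" "Ap_const p v < top" and u': "weight u" "A1_const u < top"
    using u v by (auto simp: Ap_class_def A1_class_def)
  have fm: "f \<in> borel_measurable lebesgue"
    using borel_measurable_integrable[OF f] by (simp add: uv_measure_def)
  have "weak_L1_norm (uv_measure u v) (\<lambda>x. maximal (\<lambda>y. f y * v y) x / ennreal (v x))
      \<le> ennreal (1760 * 36 ^ CARD('n)) * A1_const u * Ainf_const v *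
        (Ainf_const u * ennreal (max p (1 + ln (enn2real (Ap_const p v) + 1)))) * L1_norm (uv_measure u v) f"
    unfolding weak_L1_norm_def
  proof (rule SUP_least)
    fix t :: real assume "t \<in> {0<..}"
    then show "ennreal t * emeasure (uv_measure u v) {x \<in> space (uv_measure u v). ennreal t < maximal (\<lambda>y. f y * v y) x / ennreal (v x)}
      \<le> ennreal (1760 * 36 ^ CARD('n)) * A1_const u * Ainf_const v *
        (Ainf_const u * ennreal (max p (1 + ln (enn2real (Ap_const p v) + 1)))) * L1_norm (uv_measure u v) f"
      using mixed_weak_type_level[OF p v' u' fm, of t] by (simp add: uv_measure_def)
  qed
  \<comment> \<open>Adding the nonnegative summand \<open>A1_const u * Ainf_const v\<close> inside
    the bracket only increases the right-hand side.\<close>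
  also have "\<dots> \<le> ennreal (1760 * 36 ^ CARD('n)) * A1_const u * Ainf_const v *
          (A1_const u * Ainf_const v +
           Ainf_const u * ennreal (max p (1 + ln (enn2real (Ap_const p v) + 1)))) *
          L1_norm (uv_measure u v) f"
    by (intro mult_right_mono mult_left_mono) auto
  finally show "weak_L1_norm (uv_measure u v) (\<lambda>x. maximal (\<lambda>y. f y * v y) x / ennreal (v x))
        \<le> ennreal (1760 * 36 ^ CARD('n)) * A1_const u * Ainf_const v *
          (A1_const u * Ainf_const v +
           Ainf_const u * ennreal (max p (1 + ln (enn2real (Ap_const p v) + 1)))) *
          L1_norm (uv_measure u v) f" .
qed simp

end
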